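(* (Multi-Hamiltonian structure of the negative vector Kaup–Newell hierarchy.) Let $\omega=(\mathbf q^{\mathrm T},\mathbf r^{\mathrm T})^{\mathrm T}$ and let $W$ be the formal solution $a=\sum_{n\ge0}a_n\lambda^{-2n}$, $\mathbf d=\sum_{n\ge0}\mathbf d_n\lambda^{-2n}$, $\mathbf b=\sum_{n\ge0}\mathbf b_n\lambda^{-2n-1}$, $\mathbf c=\sum_{n\ge0}\mathbf c_n\lambda^{-2n-1}$ of $W_x=[U,W]$ described in the context. Then (formally) for every $n\ge0$ $$\begin{pmatrix}\mathbf c_n\\ \mathbf b_n\end{pmatrix}=\frac{\delta H_n^{-}}{\delta\omega},\qquad H_n^{-}=\int\frac{1}{2(n+1)}\Big[2\mathrm i\,(a_n-\mathrm{tr}\,\mathbf d_n)+\mathbf c_n^{\mathrm T}\mathbf q+\mathbf r^{\mathrm T}\mathbf b_n\Big]dx,$$ and the zero-curvature equation $U_t-V_x+[U,V]=0$ with $V=(\lambda^{2n}W)_+$ (the part with nonnegative powers of $\lambda$) is equivalent to $$\omega_t=-J\frac{\delta H_n^{-}}{\delta\omega}=-JK^{n}\frac{\delta H_0^{-}}{\delta\omega},$$ where $J=\begin{pmatrix}0&\partial_x\\ \partial_x&0\end{pmatrix}$ and $K=\partial_x^{-1}\begin{pmatrix}0&I_N\\ I_N&0\end{pmatrix}L_2\begin{pmatrix}0&I_N\\ I_N&0\end{pmatrix}$. Moreover the operators $JK^{n}$ are skew-symmetric.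
   Context: $\mathbf q=(q_1,\dots,q_N)^{\mathrm T}$, $\mathbf r=(r_1,\dots,r_N)^{\mathrm T}$ are vector functions of $(x,t)$, and $U(\lambda)=\mathrm i\lambda^{-2}\sigma_3+\lambda^{-1}Q$ with $\sigma_3=\mathrm{diag}(1,-I_N)$, $Q=\begin{pmatrix}0&\mathbf r^{\mathrm T}\\ \mathbf q&0\end{pmatrix}$. Write $W=\begin{pmatrix}a&\mathbf c^{\mathrm T}\\ \mathbf b&\mathbf d\end{pmatrix}$ with $a$ scalar, $\mathbf b,\mathbf c$ of size $N\times1$, $\mathbf d$ of size $N\times N$. For a constant $\alpha_0\in\mathbb C$ the coefficients are fixed by $a_0=\frac12\alpha_0$, $\mathbf d_0=-\frac12\alpha_0I_N$, $\mathbf b_{0,x}=\alpha_0\mathbf q$, $\mathbf c_{0,x}=-\alpha_0\mathbf r$ and, for $n\ge1$, $a_n=\partial_x^{-1}(\mathbf r^{\mathrm T}\mathbf b_{n-1}-\mathbf c_{n-1}^{\mathrm T}\mathbf q)$, $\mathbf d_n=\partial_x^{-1}(\mathbf q\mathbf c_{n-1}^{\mathrm T}-\mathbf b_{n-1}\mathbf r^{\mathrm T})$, $\begin{pmatrix}\mathbf b_n\\ \mathbf c_n\end{pmatrix}_x=L_2\begin{pmatrix}\mathbf b_{n-1}\\ \mathbf c_{n-1}\end{pmatrix}$, where $$L_2=-2\mathrm i\begin{pmatrix}I_N&0\\0&-I_N\end{pmatrix}+\begin{pmatrix}\mathbf q\partial_x^{-1}\mathbf r^{\mathrm T}+\big(\sum_{k=1}^Nq_k\partial_x^{-1}r_k\big)I_N&-\mathbf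 q\partial_x^{-1}\mathbf q^{\mathrm T}-(\mathbf q\partial_x^{-1}\mathbf q^{\mathrm T})^{\mathrm T}\\ -\mathbf r\partial_x^{-1}\mathbf r^{\mathrm T}-(\mathbf r\partial_x^{-1}\mathbf r^{\mathrm T})^{\mathrm T}&\mathbf r\partial_x^{-1}\mathbf q^{\mathrm T}+\big(\sum_{k=1}^Nr_k\partial_x^{-1}q_k\big)I_N\end{pmatrix}.$$ Here $\mathbf q\partial_x^{-1}\mathbf q^{\mathrm T}$ is the matrix of operators with $(j,k)$ entry $q_j\partial_x^{-1}q_k$, and the outer transpose exchanges the indices: $\big((\mathbf q\partial_x^{-1}\mathbf q^{\mathrm T})^{\mathrm T}\big)_{jk}=q_k\partial_x^{-1}q_j$ (similarly for $\mathbf r$). Conventions (formal calculus): $\partial_x^{-1}$ is a formal skew-adjoint inverse of $\partial_x$ with zero integration constants, and integration by parts produces no boundary terms; the variational derivative is defined by $\frac{d}{d\epsilon}H(\omega+\epsilon\eta)|_{\epsilon=0}=\int\eta^{\mathrm T}\frac{\delta H}{\delta\omega}dx$; skew-symmetry is with respect to the bilinear pairing $\int f^{\mathrm T}g\,dx$. *)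

theory Defs
  imports "HOL-Analysis.Analysis" "HOL-Complex_Analysis.Laurent_Convergence"
begin

no_notation fps_nth (infixl "$" 75)

section \<open>The formal calculus\<close>

text \<open>
  The functions of \<open>(x,t)\<close> are the elements of a commutative unital complex algebra \<open>'a\<close> with
  structure map \<open>cst\<close>. The field variables \<open>q\<^sub>j, r\<^sub>j\<close>, and everything to which
  \<open>\<partial>\<^sub>x\<^sup>-\<^sup>1\<close> is applied, belong to a subalgebra \<open>flds\<close> on which \<open>\<partial>\<^sub>x\<close> is invertible; since
  \<open>\<partial>\<^sub>x\<close> kills constants, \<open>flds\<close> contains no nonzero constant, which is how zero integration
  constants are encoded. \<open>intg f t\<close> stands for \<open>\<integral> f(x,t) dx\<close>, a function of \<open>t\<close>. No boundary
  terms are demanded only for products of two fields: demanding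
  \<open>\<integral> \<partial>\<^sub>x f dx = 0\<close> for all fields would, \<open>\<partial>\<^sub>x\<close> being onto, make \<open>\<integral>\<close> vanish
  on all of them. The value of \<open>intg\<close> on constants is arbitrary.
\<close>

record 'a calculus =
  cst :: "complex \<Rightarrow> 'a"
  dx :: "'a \<Rightarrow> 'a"
  dt :: "'a \<Rightarrow> 'a"
  flds :: "'a set"
  dxinv :: "'a \<Rightarrow> 'a"
  intg :: "'a \<Rightarrow> real \<Rightarrow> complex"

text \<open>
  The axiom \<open>nondegenerate\<close> (fundamental lemma of the calculus of variations) is what makes the
  variational derivative well defined.
\<close>

locale formal_calculus =
  fixes C :: "'a::comm_ring_1 calculus"
  assumes cst_1: "cst C 1 = 1"
    and cst_add: "cst C (z + w) = cst C z + cst C w"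
    and cst_mult: "cst C (z * w) = cst C z * cst C w"
    and dx_add: "dx C (f + g) = dx C f + dx C g"
    and dx_mult: "dx C (f * g) = dx C f * g + f * dx C g"
    and dx_cst: "dx C (cst C z) = 0"
    and dt_add: "dt C (f + g) = dt C f + dt C g"
    and dt_mult: "dt C (f * g) = dt C f * g + f * dt C g"
    and dt_cst: "dt C (cst C z) = 0"
    and dx_dt: "dx C (dt C f) = dt C (dx C f)"
    and fields_0: "0 \<in> flds C"
    and fields_add: "f \<in> flds C \<Longrightarrow> g \<in> flds C \<Longrightarrow> f + g \<in> flds C"
    and fields_scale: "f \<in> flds C \<Longrightarrow> cst C z * f \<in> flds C"
    and fields_mult: "f \<in> flds C \<Longrightarrow> g \<in> flds C \<Longrightarrow> f * g \<in> flds C"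
    and fields_dx: "f \<in> flds C \<Longrightarrow> dx C f \<in> flds C"
    and fields_dt: "f \<in> flds C \<Longrightarrow> dt C f \<in> flds C"
    and fields_dxinv: "f \<in> flds C \<Longrightarrow> dxinv C f \<in> flds C"
    and dx_dxinv: "f \<in> flds C \<Longrightarrow> dx C (dxinv C f) = f"
    and dxinv_dx: "f \<in> flds C \<Longrightarrow> dxinv C (dx C f) = f"
    and intg_add: "intg C (f + g) t = intg C f t + intg C g t"
    and intg_scale: "intg C (cst C z * f) t = z * intg C f t"
    and by_parts: "f \<in> flds C \<Longrightarrow> g \<in> flds C \<Longrightarrow>
      intg C (f * dx C g) t = - intg C (dx C f * g) t"
    and dxinv_skew: "f \<in> flds C \<Longrightarrow> g \<in> flds C \<Longrightarrow>
      intg C (f * dxinv C g) t = - intg C (dxinv C f * g) t"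
    and nondegenerate: "f \<in> flds C \<Longrightarrow>
      (\<And>g t. g \<in> flds C \<Longrightarrow> intg C (g * f) t = 0) \<Longrightarrow> f = 0"

section \<open>Pairs of vector fields, functionals and variational derivatives\<close>

text \<open>A \<open>2N\<close>-vector such as \<open>\<omega> = (q\<^sup>T, r\<^sup>T)\<^sup>T\<close> is a pair of \<open>N\<close>-vectors, \<open>N = CARD('n)\<close>.\<close>

type_synonym ('a, 'n) vec2 = "('a ^ 'n) \<times> ('a ^ 'n)"

definition vdot :: "'a::comm_ring_1 ^ 'n::finite \<Rightarrow> 'a ^ 'n \<Rightarrow> 'a" where
  "vdot v w = (\<Sum>j\<in>UNIV. v $ j * w $ j)"

definition vdot2 :: "('a::comm_ring_1, 'n::finite) vec2 \<Rightarrow> ('a, 'n::finite) vec2 \<Rightarrow> 'a" where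
  "vdot2 f g = vdot (fst f) (fst g) + vdot (snd f) (snd g)"

definition vmap :: "('a \<Rightarrow> 'b) \<Rightarrow> 'a ^ 'n \<Rightarrow> 'b ^ 'n" where
  "vmap h v = (\<chi> j. h (v $ j))"

definition vmap2 :: "('a \<Rightarrow> 'b) \<Rightarrow> ('a, 'n::finite) vec2 \<Rightarrow> ('b, 'n::finite) vec2" where
  "vmap2 h = map_prod (vmap h) (vmap h)"

definition field_vecs :: "'a calculus \<Rightarrow> ('a, 'n::finite) vec2 set" where
  "field_vecs C = {\<omega>. \<forall>j. fst \<omega> $ j \<in> flds C \<and> snd \<omega> $ j \<in> flds C}"

definition has_variational_derivative ::
    "'a::comm_ring_1 calculus \<Rightarrow> (('a, 'n::finite) vec2 \<Rightarrow> real \<Rightarrow> complex) \<Rightarrow>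
      ('a, 'n::finite) vec2 \<Rightarrow> ('a, 'n::finite) vec2 \<Rightarrow> bool" where
  "has_variational_derivative C H \<omega> G \<longleftrightarrow>
     G \<in> field_vecs C \<and>
     (\<forall>\<eta>\<in>field_vecs C. \<forall>t.
        ((\<lambda>\<epsilon>. H (\<omega> + vmap2 ((*) (cst C \<epsilon>)) \<eta>) t) has_field_derivative
           intg C (vdot2 \<eta> G) t) (at 0))"

definition variational_derivative ::
    "'a::comm_ring_1 calculus \<Rightarrow> (('a, 'n::finite) vec2 \<Rightarrow> real \<Rightarrow> complex) \<Rightarrow>
      ('a, 'n::finite) vec2 \<Rightarrow> ('a, 'n::finite) vec2" where
  "variational_derivative C H \<omega> = (THE G. has_variational_derivative C H \<omega> G)"

definition skew_symmetric ::
    "'a::comm_ring_1 calculus \<Rightarrow> (('a, 'n::finite) vec2 \<Rightarrow> ('a, 'n::finite) vec2) \<Rightarrow> bool" where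
  "skew_symmetric C T \<longleftrightarrow>
     (\<forall>f\<in>field_vecs C. \<forall>g\<in>field_vecs C. \<forall>t.
        intg C (vdot2 f (T g)) t = - intg C (vdot2 (T f) g) t)"

section \<open>The operators and the coefficients\<close>

fun L2 :: "'a::comm_ring_1 calculus \<Rightarrow> ('a, 'n::finite) vec2 \<Rightarrow> ('a, 'n::finite) vec2 \<Rightarrow> ('a, 'n::finite) vec2" where
  "L2 C (q, r) (b, c) =
    ((\<chi> j. cst C (- 2 * \<i>) * b $ j
        + (\<Sum>k\<in>UNIV. q $ j * dxinv C (r $ k * b $ k))
        + (\<Sum>k\<in>UNIV. q $ k * dxinv C (r $ k * b $ j))
        - (\<Sum>k\<in>UNIV. q $ j * dxinv C (q $ k * c $ k))
        - (\<Sum>k\<in>UNIV. q $ k * dxinv C (q $ j * c $ k))),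
     (\<chi> j. cst C (2 * \<i>) * c $ j
        - (\<Sum>k\<in>UNIV. r $ j * dxinv C (r $ k * b $ k))
        - (\<Sum>k\<in>UNIV. r $ k * dxinv C (r $ j * b $ k))
        + (\<Sum>k\<in>UNIV. r $ j * dxinv C (q $ k * c $ k))
        + (\<Sum>k\<in>UNIV. r $ k * dxinv C (q $ k * c $ j))))"

definition J_op :: "'a::comm_ring_1 calculus \<Rightarrow> ('a, 'n::finite) vec2 \<Rightarrow> ('a, 'n::finite) vec2" where
  "J_op C f = vmap2 (dx C) (prod.swap f)"

definition K_op ::
    "'a::comm_ring_1 calculus \<Rightarrow> ('a, 'n::finite) vec2 \<Rightarrow> ('a, 'n::finite) vec2 \<Rightarrow> ('a, 'n::finite) vec2" where
  "K_op C \<omega> f = vmap2 (dxinv C) (prod.swap (L2 C \<omega> (prod.swap f)))"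

text \<open>The pair \<open>(b\<^sub>n, c\<^sub>n)\<close>.\<close>

primrec bc_coeff ::
    "'a::comm_ring_1 calculus \<Rightarrow> complex \<Rightarrow> ('a, 'n::finite) vec2 \<Rightarrow> nat \<Rightarrow> ('a, 'n::finite) vec2" where
  "bc_coeff C \<alpha> \<omega> 0 =
     (vmap (\<lambda>f. dxinv C (cst C \<alpha> * f)) (fst \<omega>), vmap (\<lambda>f. dxinv C (- cst C \<alpha> * f)) (snd \<omega>))"
| "bc_coeff C \<alpha> \<omega> (Suc n) = vmap2 (dxinv C) (L2 C \<omega> (bc_coeff C \<alpha> \<omega> n))"

definition b_coeff where "b_coeff C \<alpha> \<omega> n = fst (bc_coeff C \<alpha> \<omega> n)"
definition c_coeff where "c_coeff C \<alpha> \<omega> n = snd (bc_coeff C \<alpha> \<omega> n)"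

fun a_coeff ::
    "'a::comm_ring_1 calculus \<Rightarrow> complex \<Rightarrow> ('a, 'n::finite) vec2 \<Rightarrow> nat \<Rightarrow> 'a" where
  "a_coeff C \<alpha> (q, r) 0 = cst C (\<alpha> / 2)"
| "a_coeff C \<alpha> (q, r) (Suc n) =
     dxinv C (vdot r (b_coeff C \<alpha> (q, r) n) - vdot (c_coeff C \<alpha> (q, r) n) q)"

fun d_coeff ::
    "'a::comm_ring_1 calculus \<Rightarrow> complex \<Rightarrow> ('a, 'n::finite) vec2 \<Rightarrow> nat \<Rightarrow> 'a ^ 'n ^ 'n" where
  "d_coeff C \<alpha> (q, r) 0 = mat (cst C (- \<alpha> / 2))"
| "d_coeff C \<alpha> (q, r) (Suc n) =
     (\<chi> j k. dxinv C (q $ j * c_coeff C \<alpha> (q, r) n $ k - b_coeff C \<alpha> (q, r) n $ j * r $ k))"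

text \<open>The functional \<open>H\<^sub>n\<^sup>-\<close>.\<close>

fun hamiltonian ::
    "'a::comm_ring_1 calculus \<Rightarrow> complex \<Rightarrow> nat \<Rightarrow> ('a, 'n::finite) vec2 \<Rightarrow> real \<Rightarrow> complex" where
  "hamiltonian C \<alpha> n (q, r) =
     intg C (cst C (1 / (2 * (of_nat n + 1))) *
       (cst C (2 * \<i>) * (a_coeff C \<alpha> (q, r) n - trace (d_coeff C \<alpha> (q, r) n))
        + vdot (c_coeff C \<alpha> (q, r) n) q + vdot r (b_coeff C \<alpha> (q, r) n)))"

section \<open>The Lax matrices\<close>

text \<open>
  \<open>(1+N) \<times> (1+N)\<close> matrices are indexed by \<open>'n option\<close>, the index \<open>None\<close> being the first one.
  Their entries are formal Laurent series in the variable \<open>fls_X = \<lambda>\<^sup>-\<^sup>1\<close>, so that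
  \<open>fls_X_inv = \<lambda>\<close> and the coefficient \<open>fls_nth f k\<close> belongs to \<open>\<lambda>\<^sup>-\<^sup>k\<close>.
\<close>

type_synonym ('b, 'n) bmat = "'b ^ ('n option) ^ ('n option)"

definition block :: "'b \<Rightarrow> 'b ^ 'n \<Rightarrow> 'b ^ 'n \<Rightarrow> 'b ^ 'n ^ 'n \<Rightarrow> ('b, 'n::finite) bmat" where
  "block a c b d = (\<chi> i j. case i of
       None \<Rightarrow> (case j of None \<Rightarrow> a | Some k \<Rightarrow> c $ k)
     | Some l \<Rightarrow> (case j of None \<Rightarrow> b $ l | Some k \<Rightarrow> d $ l $ k))"

definition mmap :: "('b \<Rightarrow> 'c) \<Rightarrow> 'b ^ 'm ^ 'k \<Rightarrow> 'c ^ 'm ^ 'k" where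
  "mmap h A = (\<chi> i j. h (A $ i $ j))"

definition comm :: "'b::comm_ring_1 ^ 'm ^ 'm \<Rightarrow> 'b ^ 'm ^ 'm \<Rightarrow> 'b ^ 'm ^ 'm" where
  "comm A B = A ** B - B ** A"

text \<open>Derivations act on a series coefficientwise.\<close>

definition fls_map :: "('a \<Rightarrow> 'a) \<Rightarrow> 'a::zero fls \<Rightarrow> 'a fls" where
  "fls_map h f = Abs_fls (\<lambda>k. h (fls_nth f k))"

text \<open>The part with nonnegative powers of \<open>\<lambda>\<close>.\<close>

definition fls_plus :: "'a::zero fls \<Rightarrow> 'a fls" where
  "fls_plus f = Abs_fls (\<lambda>k. if k \<le> 0 then fls_nth f k else 0)"

definition sigma3 :: "('a::comm_ring_1, 'n::finite) bmat" where
  "sigma3 = block 1 0 0 (mat (- 1))"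

fun Q_mat :: "('a::comm_ring_1, 'n::finite) vec2 \<Rightarrow> ('a, 'n::finite) bmat" where
  "Q_mat (q, r) = block 0 r q 0"

definition U_mat :: "'a::comm_ring_1 calculus \<Rightarrow> ('a, 'n::finite) vec2 \<Rightarrow> ('a fls, 'n::finite) bmat" where
  "U_mat C \<omega> = mmap (\<lambda>s. fls_X ^ 2 * fls_const (cst C \<i> * s)) sigma3
             + mmap (\<lambda>s. fls_X * fls_const s) (Q_mat \<omega>)"

text \<open>The series \<open>\<Sum>n. f n * \<lambda>\<^sup>-\<^sup>2\<^sup>n\<close> and \<open>\<Sum>n. f n * \<lambda>\<^sup>-\<^sup>2\<^sup>n\<^sup>-\<^sup>1\<close>.\<close>

definition even_series :: "(nat \<Rightarrow> 'a::zero) \<Rightarrow> 'a fls" where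
  "even_series f = fps_to_fls (Abs_fps (\<lambda>k. if even k then f (k div 2) else 0))"

definition odd_series :: "(nat \<Rightarrow> 'a::zero) \<Rightarrow> 'a fls" where
  "odd_series f = fps_to_fls (Abs_fps (\<lambda>k. if odd k then f (k div 2) else 0))"

definition W_mat ::
    "'a::comm_ring_1 calculus \<Rightarrow> complex \<Rightarrow> ('a, 'n::finite) vec2 \<Rightarrow> ('a fls, 'n::finite) bmat" where
  "W_mat C \<alpha> \<omega> = block
     (even_series (a_coeff C \<alpha> \<omega>))
     (\<chi> j. odd_series (\<lambda>n. c_coeff C \<alpha> \<omega> n $ j))
     (\<chi> j. odd_series (\<lambda>n. b_coeff C \<alpha> \<omega> n $ j))
     (\<chi> j k. even_series (\<lambda>n. d_coeff C \<alpha> \<omega> n $ j $ k))"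

definition V_mat ::
    "'a::comm_ring_1 calculus \<Rightarrow> complex \<Rightarrow> nat \<Rightarrow> ('a, 'n::finite) vec2 \<Rightarrow> ('a fls, 'n::finite) bmat" where
  "V_mat C \<alpha> n \<omega> = mmap (\<lambda>w. fls_plus (fls_X_inv ^ (2 * n) * w)) (W_mat C \<alpha> \<omega>)"

definition zero_curvature ::
    "'a::comm_ring_1 calculus \<Rightarrow> ('a fls, 'n::finite) bmat \<Rightarrow> ('a fls, 'n::finite) bmat \<Rightarrow> bool" where
  "zero_curvature C U V \<longleftrightarrow>
     mmap (fls_map (dt C)) U - mmap (fls_map (dx C)) V + comm U V = 0"

end

theory Submission
  imports Defs
begin

text \<open>
  Write \<open>\<zeta> = \<lambda>\<^sup>-\<^sup>1\<close>. The recursion says \<open>W\<^sub>x = [U, W]\<close>; then \<open>W\<^sup>2\<close> solves the same equation, and since a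
  solution with field coefficients must vanish, \<open>W\<^sup>2 = \<alpha>\<^sup>2 / 4\<close>. Hence \<open>\<delta>W\<close> and \<open>W\<^sub>\<zeta>\<close> anticommute
  with \<open>W\<close>, which gives, for \<open>\<alpha> \<noteq> 0\<close> (otherwise \<open>W = 0\<close>),
  \<open>\<partial>\<^sub>x tr (W \<delta>W W\<^sub>\<zeta>) = (\<alpha>\<^sup>2 / 2) (tr (U\<^sub>\<zeta> \<delta>W) - tr (\<delta>U W\<^sub>\<zeta>))\<close>. The left side integrates to zero, so
  \<open>\<delta> \<integral> tr (U\<^sub>\<zeta> W) dx = \<partial>\<^sub>\<zeta> \<integral> tr (\<delta>U W) dx\<close>, whose coefficients are the variational formula.
  The variation \<open>\<delta>\<close> is realised as the derivative in \<open>\<epsilon>\<close> over the calculus of polynomials in \<open>\<epsilon>\<close>.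
  Skew-symmetry of \<open>J K\<^sup>n\<close> follows from \<open>\<langle>f, J K g\<rangle> = \<langle>K f, J g\<rangle>\<close>.
\<close>

section \<open>Matrices over a commutative ring with derivations\<close>

lemma matrix_diff_ldistrib: "A ** (B - C) = A ** B - A ** (C :: 'a::comm_ring_1 ^ 'm ^ 'n)"
  by (simp add: matrix_matrix_mult_def vec_eq_iff right_diff_distrib sum_subtractf)

lemma matrix_diff_rdistrib: "(A - B) ** C = A ** C - B ** (C :: 'a::comm_ring_1 ^ 'm ^ 'n)"
  by (simp add: matrix_matrix_mult_def vec_eq_iff left_diff_distrib sum_subtractf)

lemma matrix_add_rdistrib: "(A + B) ** C = A ** C + B ** (C :: 'a::comm_ring_1 ^ 'm ^ 'n)"
  by (simp add: matrix_matrix_mult_def vec_eq_iff distrib_right sum.distrib)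

lemma mat_mult_left: "mat k ** A = mmap ((*) k) (A :: 'a::comm_ring_1 ^ 'm ^ 'n)"
  by (simp add: matrix_matrix_mult_def mmap_def vec_eq_iff mat_def if_distrib if_distribR
      cong: if_cong)

lemma mat_mult_right: "A ** mat k = mmap ((*) k) (A :: 'a::comm_ring_1 ^ 'm ^ 'n)"
  by (simp add: matrix_matrix_mult_def mmap_def vec_eq_iff mat_def if_distrib if_distribR
      mult.commute cong: if_cong)

lemma trace_mmap_mult: "trace (mmap ((*) k) A) = k * trace (A :: 'a::comm_ring_1 ^ 'n ^ 'n)"
  by (simp add: trace_def mmap_def sum_distrib_left)

lemma mmap_nth [simp]: "mmap h A $ i $ j = h (A $ i $ j)"
  by (simp add: mmap_def)

lemma vmap_nth [simp]: "vmap h v $ j = h (v $ j)"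
  by (simp add: vmap_def)

locale derivation =
  fixes D :: "'a::comm_ring_1 \<Rightarrow> 'a"
  assumes add: "D (f + g) = D f + D g"
    and mult: "D (f * g) = D f * g + f * D g"
begin

lemma zero [simp]: "D 0 = 0"
  using add[of 0 0] by simp

lemma uminus: "D (- f) = - D f"
  using add[of f "- f"] by (simp add: eq_neg_iff_add_eq_0 add.commute)

lemma diff: "D (f - g) = D f - D g"
  using add[of f "- g"] by (simp add: uminus)

lemma one [simp]: "D 1 = 0"
  using mult[of 1 1] by simp

lemma of_nat [simp]: "D (of_nat n) = 0"
  by (induction n) (simp_all add: add)

lemma sum: "D (sum f A) = (\<Sum>i\<in>A. D (f i))"
  by (induction A rule: infinite_finite_induct) (simp_all add: add)

lemma matrix_mult: "mmap D (A ** B) = mmap D A ** B + A ** mmap D B"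
  by (simp add: matrix_matrix_mult_def vec_eq_iff sum mult sum.distrib)

lemma matrix_diff: "mmap D (A - B) = mmap D A - mmap D B"
  by (simp add: vec_eq_iff diff)

lemma matrix_comm: "mmap D (comm A B) = comm (mmap D A) B + comm A (mmap D B)"
  by (simp add: comm_def matrix_diff matrix_mult)

lemma trace: "trace (mmap D A) = D (trace A)"
  by (simp add: trace_def sum)

end

text \<open>Replaces the diagonalisation of \<open>W\<close> in the usual proofs of the trace identity.\<close>

lemma anticommute_of_square_scalar:
  assumes "derivation D" and W2: "W ** W = mat k" and k: "D k = 0"
  shows "mmap D W ** W = - (W ** mmap D W)"
proof -
  interpret derivation D by fact
  have "mmap D (mat k) = (0 :: 'a ^ 'b ^ 'b)"
    by (simp add: vec_eq_iff mat_def k)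
  then show ?thesis
    using matrix_mult[of W W] W2 by (simp add: eq_neg_iff_add_eq_0)
qed

lemma trace_uminus: "trace (- A) = - trace (A :: 'a::comm_ring_1 ^ 'n ^ 'n)"
  by (simp add: trace_def sum_negf)

lemma matrix_uminus_left: "(- A) ** B = - (A ** (B :: 'a::comm_ring_1 ^ 'm ^ 'n))"
  by (simp add: matrix_matrix_mult_def vec_eq_iff sum_negf)

lemma matrix_uminus_right: "A ** (- B) = - (A ** (B :: 'a::comm_ring_1 ^ 'm ^ 'n))"
  by (simp add: matrix_matrix_mult_def vec_eq_iff sum_negf)

text \<open>By the Leibniz rule, all terms of \<open>X\<close> applied to the triple product that
  contain \<open>U\<close> itself form a commutator with \<open>U\<close>, which has trace zero.
  Only \<open>[E U, W]\<close> and \<open>[Z U, W]\<close> remain. Since the derivatives of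
  \<open>W\<close> anticommute with \<open>W\<close> and \<open>W ** W\<close> is scalar, the two
  halves of each of these commutators add up under the trace; hence the factor
  \<open>2 * k\<close>.\<close>

lemma trace_identity:
  fixes U W :: "'a::comm_ring_1 ^ 'n ^ 'n"
  assumes X: "derivation X" and E: "derivation E" and Z: "derivation Z"
    and XE: "\<And>f. X (E f) = E (X f)" and XZ: "\<And>f. X (Z f) = Z (X f)"
    and Wx: "mmap X W = comm U W" and W2: "W ** W = mat k" and Ek: "E k = 0" and Zk: "Z k = 0"
  shows "X (trace (W ** mmap E W ** mmap Z W)) =
    2 * k * (trace (mmap Z U ** mmap E W) - trace (mmap E U ** mmap Z W))"
proof -
  define A where "A = mmap E W"
  define B where "B = mmap Z W"
  define F where "F = mmap E U"
  define G where "G = mmap Z U"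
  have AW: "A ** W = - (W ** A)"
    unfolding A_def by (rule anticommute_of_square_scalar[OF E W2 Ek])
  have BW: "B ** W = - (W ** B)"
    unfolding B_def by (rule anticommute_of_square_scalar[OF Z W2 Zk])
  have Ax: "mmap X A = comm F W + comm U A"
  proof -
    have "mmap X A = mmap E (mmap X W)" by (simp add: A_def vec_eq_iff XE)
    then show ?thesis by (simp add: Wx derivation.matrix_comm[OF E] A_def F_def)
  qed
  have Bx: "mmap X B = comm G W + comm U B"
  proof -
    have "mmap X B = mmap Z (mmap X W)" by (simp add: B_def vec_eq_iff XZ)
    then show ?thesis by (simp add: Wx derivation.matrix_comm[OF Z] B_def G_def)
  qed
  have WW: "W ** W ** M = mmap ((*) k) M" for M :: "'a ^ 'n ^ 'n"
    by (simp add: W2 mat_mult_left)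
  have "mmap X (W ** A ** B) = comm U (W ** A ** B) + W ** comm F W ** B + W ** A ** comm G W"
    unfolding derivation.matrix_mult[OF X] Wx Ax Bx comm_def
    by (simp add: matrix_add_ldistrib matrix_add_rdistrib matrix_diff_ldistrib
        matrix_diff_rdistrib matrix_mul_assoc matrix_uminus_left)
  moreover have "trace (comm U M) = 0" for M
    by (simp add: comm_def trace_sub trace_mul_sym[of U M])
  ultimately have "trace (mmap X (W ** A ** B)) = trace (W ** comm F W ** B) + trace (W ** A ** comm G W)"
    by (simp add: trace_add)
  moreover have "trace (W ** comm F W ** B) = - 2 * k * trace (F ** B)"
  proof -
    have "W ** comm F W ** B = W ** F ** W ** B - W ** W ** F ** B"
      by (simp add: comm_def matrix_diff_ldistrib matrix_diff_rdistrib matrix_mul_assoc)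
    moreover have "trace (W ** F ** W ** B) = trace (F ** (W ** B ** W))"
      by (metis matrix_mul_assoc trace_mul_sym)
    moreover have "W ** B ** W = - mmap ((*) k) B"
      by (metis BW WW matrix_mul_assoc matrix_uminus_right)
    moreover have "F ** mmap ((*) k) B = mmap ((*) k) (F ** B)"
      by (metis mat_mult_left mat_mult_right matrix_mul_assoc)
    moreover have "W ** W ** F ** B = mmap ((*) k) (F ** B)"
      by (metis WW matrix_mul_assoc)
    ultimately show ?thesis
      by (simp add: trace_sub trace_mmap_mult matrix_uminus_right trace_uminus)
  qed
  moreover have "trace (W ** A ** comm G W) = 2 * k * trace (G ** A)"
  proof -
    have "W ** A ** comm G W = W ** A ** G ** W - W ** A ** W ** G"
      by (simp add: comm_def matrix_diff_ldistrib matrix_mul_assoc)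
    moreover have "trace (W ** A ** G ** W) = trace (W ** W ** (A ** G))"
      by (metis matrix_mul_assoc trace_mul_sym)
    moreover have "W ** A ** W ** G = - mmap ((*) k) (A ** G)"
      by (metis AW WW matrix_mul_assoc matrix_uminus_right matrix_uminus_left)
    ultimately show ?thesis
      by (simp add: trace_sub trace_add trace_mmap_mult trace_uminus WW trace_mul_sym[of G A])
  qed
  ultimately show ?thesis
    by (simp add: derivation.trace[OF X] A_def B_def F_def G_def algebra_simps)
qed

section \<open>Block matrices\<close>

lemma sum_option_UNIV: "(\<Sum>i\<in>UNIV. f i) = f None + (\<Sum>j\<in>UNIV. f (Some (j :: 'n::finite)))"
  by (simp add: UNIV_option_conv sum.reindex)

lemma block_nth [simp]:
  "block a c b d $ None $ None = a" "block a c b d $ None $ Some k = c $ k"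
  "block a c b d $ Some j $ None = b $ j" "block a c b d $ Some j $ Some k = d $ j $ k"
  by (simp_all add: block_def)

lemma bmat_eq_iff:
  "A = B \<longleftrightarrow> A $ None $ None = B $ None $ None \<and> (\<forall>k. A $ None $ Some k = B $ None $ Some k) \<and>
    (\<forall>j. A $ Some j $ None = B $ Some j $ None) \<and> (\<forall>j k. A $ Some j $ Some k = B $ Some j $ Some k)"
  by (auto simp: vec_eq_iff split_option_all)

lemma trace_block: "trace (block a c b d) = a + trace d"
  by (simp add: trace_def sum_option_UNIV)

lemma block_mult:
  "block a c b d ** block a' c' b' d' =
    block (a * a' + vdot c b') (\<chi> j. a * c' $ j + (\<Sum>k\<in>UNIV. c $ k * d' $ k $ j))
      (\<chi> j. b $ j * a' + (\<Sum>k\<in>UNIV. d $ j $ k * b' $ k)) (\<chi> j k. b $ j * c' $ k + (d ** d') $ j $ k)"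
  by (simp add: bmat_eq_iff matrix_matrix_mult_def sum_option_UNIV vdot_def)

text \<open>The first factor has the shape of \<open>U\<close>: a multiple of \<open>sigma3\<close>
  plus an off-diagonal part. The multiple of \<open>sigma3\<close> cancels in the diagonal blocks
  and doubles in the others.\<close>

lemma comm_block:
  "comm (block u r q (mat (- u))) (block a c b d) =
    block (vdot r b - vdot c q) (\<chi> j. 2 * u * c $ j + ((\<Sum>k\<in>UNIV. r $ k * d $ k $ j) - r $ j * a))
      (\<chi> j. (q $ j * a - (\<Sum>k\<in>UNIV. q $ k * d $ j $ k)) - 2 * u * b $ j) (\<chi> j k. q $ j * c $ k - b $ j * r $ k)"
  unfolding comm_def block_mult mat_mult_left mat_mult_right
  by (simp add: bmat_eq_iff mat_def if_distrib if_distribR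
      algebra_simps cong: if_cong)

lemma mmap_block: "mmap h (block a c b d) = block (h a) (vmap h c) (vmap h b) (mmap h d)"
  by (simp add: bmat_eq_iff vmap_def)

section \<open>Formal power series with a coefficientwise operator\<close>

definition fps_map :: "('a \<Rightarrow> 'b) \<Rightarrow> 'a fps \<Rightarrow> 'b fps" where
  "fps_map h F = Abs_fps (\<lambda>k. h (fps_nth F k))"

lemma fps_map_nth [simp]: "fps_nth (fps_map h F) k = h (fps_nth F k)"
  by (simp add: fps_map_def)

lemma derivation_fps_map:
  assumes "derivation D"
  shows "derivation (fps_map D)"
proof -
  interpret derivation D by fact
  show ?thesis
    by standard (simp_all add: fps_eq_iff fps_mult_nth add sum mult sum.distrib)
qed

lemma derivation_fps_deriv: "derivation (fps_deriv :: 'a::comm_ring_1 fps \<Rightarrow> 'a fps)"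
  by standard (simp_all add: algebra_simps)

text \<open>The factors \<open>k + 1\<close> of the formal derivative are integers, and a derivation
  kills integers.\<close>

lemma fps_map_deriv_commute:
  assumes "derivation D"
  shows "fps_map D (fps_deriv F) = fps_deriv (fps_map D F)"
proof -
  interpret derivation D by fact
  have "D (1 + of_nat k) = 0" for k by (simp add: add)
  then show ?thesis
    by (simp add: fps_eq_iff mult)
qed

section \<open>The spatial part of the formal calculus\<close>

text \<open>The axioms about \<open>x\<close>, without nondegeneracy: these survive the passage to polynomials in a
  deformation parameter.\<close>

locale spatial_calculus =
  fixes C :: "'a::comm_ring_1 calculus"
  assumes cst_1 [simp]: "cst C 1 = 1"
    and cst_add: "cst C (z + w) = cst C z + cst C w"
    and cst_mult: "cst C (z * w) = cst C z * cst C w"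
    and dx_add: "dx C (f + g) = dx C f + dx C g"
    and dx_mult: "dx C (f * g) = dx C f * g + f * dx C g"
    and dx_cst [simp]: "dx C (cst C z) = 0"
    and fields_0 [simp]: "0 \<in> flds C"
    and fields_add: "f \<in> flds C \<Longrightarrow> g \<in> flds C \<Longrightarrow> f + g \<in> flds C"
    and fields_scale: "f \<in> flds C \<Longrightarrow> cst C z * f \<in> flds C"
    and fields_mult: "f \<in> flds C \<Longrightarrow> g \<in> flds C \<Longrightarrow> f * g \<in> flds C"
    and fields_dx: "f \<in> flds C \<Longrightarrow> dx C f \<in> flds C"
    and fields_dxinv: "f \<in> flds C \<Longrightarrow> dxinv C f \<in> flds C"
    and dx_dxinv: "f \<in> flds C \<Longrightarrow> dx C (dxinv C f) = f"
    and dxinv_dx: "f \<in> flds C \<Longrightarrow> dxinv C (dx C f) = f"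
    and intg_add: "intg C (f + g) t = intg C f t + intg C g t"
    and intg_scale: "intg C (cst C z * f) t = z * intg C f t"
    and by_parts: "f \<in> flds C \<Longrightarrow> g \<in> flds C \<Longrightarrow>
      intg C (f * dx C g) t = - intg C (dx C f * g) t"
    and dxinv_skew: "f \<in> flds C \<Longrightarrow> g \<in> flds C \<Longrightarrow>
      intg C (f * dxinv C g) t = - intg C (dxinv C f * g) t"

lemma (in formal_calculus) spatial_calculus: "spatial_calculus C"
  by standard
    (simp_all add: cst_1 cst_add cst_mult dx_add dx_mult dx_cst fields_0 fields_add fields_scale
      fields_mult fields_dx fields_dxinv dx_dxinv dxinv_dx intg_add intg_scale by_parts dxinv_skew)

context spatial_calculus
begin

section \<open>Elementary consequences of the axioms about \<open>x\<close>\<close>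

lemma derivation_dx: "derivation (dx C)"
  by standard (simp_all add: dx_add dx_mult)

sublocale dx: derivation "dx C"
  by (rule derivation_dx)

lemma cst_0 [simp]: "cst C 0 = 0"
  using cst_add[of 0 0] by simp

lemma cst_uminus: "cst C (- z) = - cst C z"
  using cst_add[of z "- z"] by (simp add: eq_neg_iff_add_eq_0 add.commute)

lemma cst_of_nat: "cst C (of_nat n) = of_nat n"
  by (induction n) (simp_all add: cst_add)

lemma dx_scale: "dx C (cst C z * f) = cst C z * dx C f"
  by (simp add: dx_mult)

lemma fields_uminus: "f \<in> flds C \<Longrightarrow> - f \<in> flds C"
  using fields_scale[of f "- 1"] by (simp add: cst_uminus)

lemma fields_diff: "f \<in> flds C \<Longrightarrow> g \<in> flds C \<Longrightarrow> f - g \<in> flds C"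
  using fields_add[of f "- g"] by (simp add: fields_uminus)

lemma fields_sum: "(\<And>i. i \<in> A \<Longrightarrow> f i \<in> flds C) \<Longrightarrow> sum f A \<in> flds C"
  by (induction A rule: infinite_finite_induct) (simp_all add: fields_add)

text \<open>On fields \<open>dx\<close> is injective, so a field antiderivative is unique; the
  linearity rules for \<open>dxinv\<close> rest on this.\<close>

lemma dxinv_eqI: "f \<in> flds C \<Longrightarrow> g \<in> flds C \<Longrightarrow> dx C g = f \<Longrightarrow> dxinv C f = g"
  using dxinv_dx by blast

lemma dxinv_0 [simp]: "dxinv C 0 = 0"
  by (rule dxinv_eqI) simp_all

lemma dxinv_add: "f \<in> flds C \<Longrightarrow> g \<in> flds C \<Longrightarrow> dxinv C (f + g) = dxinv C f + dxinv C g"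
  by (rule dxinv_eqI) (simp_all add: fields_add fields_dxinv dx_dxinv dx_add)

lemma dxinv_scale: "f \<in> flds C \<Longrightarrow> dxinv C (cst C z * f) = cst C z * dxinv C f"
  by (rule dxinv_eqI) (simp_all add: fields_scale fields_dxinv dx_dxinv dx_scale)

lemma dxinv_uminus: "f \<in> flds C \<Longrightarrow> dxinv C (- f) = - dxinv C f"
  by (rule dxinv_eqI) (simp_all add: fields_uminus fields_dxinv dx_dxinv dx.uminus)

lemma dxinv_diff: "f \<in> flds C \<Longrightarrow> g \<in> flds C \<Longrightarrow> dxinv C (f - g) = dxinv C f - dxinv C g"
  using dxinv_add[of f "- g"] by (simp add: dxinv_uminus fields_uminus)

lemma dxinv_sum:
  "(\<And>i. i \<in> A \<Longrightarrow> f i \<in> flds C) \<Longrightarrow> dxinv C (sum f A) = (\<Sum>i\<in>A. dxinv C (f i))"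
  by (induction A rule: infinite_finite_induct) (simp_all add: dxinv_add fields_sum)

lemma intg_0 [simp]: "intg C 0 t = 0"
  using intg_add[of 0 0 t] by simp

lemma intg_uminus: "intg C (- f) t = - intg C f t"
  using intg_add[of f "- f" t] by (simp add: eq_neg_iff_add_eq_0 add.commute)

lemma intg_diff: "intg C (f - g) t = intg C f t - intg C g t"
  using intg_add[of f "- g" t] by (simp add: intg_uminus)

lemma intg_sum: "intg C (sum f A) t = (\<Sum>i\<in>A. intg C (f i) t)"
  by (induction A rule: infinite_finite_induct) (simp_all add: intg_add)

text \<open>Boundary terms are excluded only for products of two fields, so later arguments must
  exhibit such a factorisation before discarding a total derivative.\<close>

lemma intg_dx_mult: "f \<in> flds C \<Longrightarrow> g \<in> flds C \<Longrightarrow> intg C (dx C (f * g)) t = 0"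
  by (simp add: dx_mult intg_add by_parts)

subsection \<open>Series with field coefficients\<close>

definition fld_series :: "'a fps set" where
  "fld_series = {F. \<forall>k. fps_nth F k \<in> flds C}"

text \<open>\<open>fld_series\<close> is an ideal of the ring of series whose leading coefficient is a constant and
  whose other coefficients are fields.\<close>

definition coeff_series :: "'a fps set" where
  "coeff_series = {F. fps_nth F 0 \<in> range (cst C) \<and> (\<forall>k>0. fps_nth F k \<in> flds C)}"

lemma cst_or_field_mult:
  "f \<in> range (cst C) \<union> flds C \<Longrightarrow> g \<in> flds C \<Longrightarrow> f * g \<in> flds C"
  "f \<in> range (cst C) \<union> flds C \<Longrightarrow> g \<in> flds C \<Longrightarrow> g * f \<in> flds C"
  by (auto simp: fields_mult fields_scale mult.commute[of g])

lemma coeff_series_nth: "F \<in> coeff_series \<Longrightarrow> fps_nth F k \<in> range (cst C) \<union> flds C"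
  by (cases "k = 0") (auto simp: coeff_series_def)

lemma fld_series_mult: "F \<in> coeff_series \<Longrightarrow> G \<in> fld_series \<Longrightarrow> F * G \<in> fld_series"
  by (simp add: fld_series_def fps_mult_nth fields_sum cst_or_field_mult(1)[OF coeff_series_nth])

lemma fld_series_sum: "(\<And>i. i \<in> A \<Longrightarrow> F i \<in> fld_series) \<Longrightarrow> sum F A \<in> fld_series"
  by (simp add: fld_series_def fps_sum_nth fields_sum)

text \<open>In a coefficient of positive order, every summand of the convolution has a factor of
  positive order, which is a field and absorbs the other factor.\<close>

lemma coeff_series_mult:
  assumes F: "F \<in> coeff_series" and G: "G \<in> coeff_series"
  shows "F * G \<in> coeff_series"
proof -
  have "fps_nth (F * G) k \<in> flds C" if "k > 0" for k
    unfolding fps_mult_nth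
  proof (rule fields_sum)
    fix i assume "i \<in> {0..k}"
    show "fps_nth F i * fps_nth G (k - i) \<in> flds C"
    proof (cases "i = 0")
      case True
      then show ?thesis
        using G that cst_or_field_mult(1)[OF coeff_series_nth[OF F]] by (simp add: coeff_series_def)
    next
      case False
      then show ?thesis
        using F cst_or_field_mult(2)[OF coeff_series_nth[OF G]] by (simp add: coeff_series_def)
    qed
  qed
  moreover have "fps_nth (F * G) 0 \<in> range (cst C)"
    using F G by (auto simp: coeff_series_def cst_mult[symmetric])
  ultimately show ?thesis by (simp add: coeff_series_def)
qed

lemma coeff_series_add: "F \<in> coeff_series \<Longrightarrow> G \<in> coeff_series \<Longrightarrow> F + G \<in> coeff_series"
  by (auto simp: coeff_series_def fields_add cst_add[symmetric])

lemma coeff_series_sum: "(\<And>i. i \<in> A \<Longrightarrow> F i \<in> coeff_series) \<Longrightarrow> sum F A \<in> coeff_series"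
proof (induction A rule: infinite_finite_induct)
  case empty
  show ?case by (auto simp: coeff_series_def intro: rangeI[of "cst C" 0, simplified])
next
  case (infinite A)
  then show ?case by (auto simp: coeff_series_def intro: rangeI[of "cst C" 0, simplified])
qed (simp add: coeff_series_add)

text \<open>As \<open>U\<close> has no constant term, order \<open>k\<close> of
  \<open>comm U Y\<close> involves only lower orders of \<open>Y\<close>. Inductively these vanish,
  so the coefficient of order \<open>k\<close> is a field with derivative zero, hence zero.\<close>

lemma lax_solution_unique:
  assumes Y: "\<And>i j. Y $ i $ j \<in> fld_series" and U: "\<And>i j. fps_nth (U $ i $ j) 0 = 0"
    and Yx: "mmap (fps_map (dx C)) Y = comm U Y"
  shows "Y = 0"
proof -
  have "fps_nth (Y $ i $ j) k = 0" for i j k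
  proof (induction k arbitrary: i j rule: less_induct)
    case (less k)
    have *: "fps_nth (F * G) k = 0" if "fps_nth F 0 = 0" "\<And>m. m < k \<Longrightarrow> fps_nth G m = 0" for F G :: "'a fps"
      unfolding fps_mult_nth
    proof (rule sum.neutral, rule ballI)
      fix i assume "i \<in> {0..k}"
      then show "fps_nth F i * fps_nth G (k - i) = 0"
        using that by (cases "i = 0") auto
    qed
    have "dx C (fps_nth (Y $ i $ j) k) = fps_nth (mmap (fps_map (dx C)) Y $ i $ j) k"
      by simp
    also have "\<dots> = 0"
      unfolding Yx comm_def matrix_matrix_mult_def
      using * less.IH U by (simp add: fps_sum_nth mult.commute[of "Y $ _ $ _"])
    finally show ?case
      using dxinv_dx[of "fps_nth (Y $ i $ j) k"] Y by (simp add: fld_series_def)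
  qed
  then show ?thesis by (simp add: vec_eq_iff fps_eq_iff)
qed

lemma intg_dx_fld_series_mult:
  assumes "F \<in> fld_series" "G \<in> fld_series"
  shows "intg C (dx C (fps_nth (F * G) k)) t = 0"
  using assms by (simp add: fps_mult_nth dx.sum intg_sum intg_dx_mult fld_series_def)

subsection \<open>The coefficients and the formal solution\<close>

lemma field_vecs_iff: "(f, g) \<in> field_vecs C \<longleftrightarrow> (\<forall>j. f $ j \<in> flds C) \<and> (\<forall>j. g $ j \<in> flds C)"
  by (auto simp: field_vecs_def)

lemma L2_fields:
  "\<omega> \<in> field_vecs C \<Longrightarrow> f \<in> field_vecs C \<Longrightarrow> L2 C \<omega> f \<in> field_vecs C"
  by (cases \<omega>; cases f)
    (simp add: field_vecs_iff fields_add fields_diff fields_sum fields_scale fields_mult fields_dxinv)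

lemma vmap2_dxinv_fields: "f \<in> field_vecs C \<Longrightarrow> vmap2 (dxinv C) f \<in> field_vecs C"
  by (cases f) (simp add: field_vecs_iff vmap2_def vmap_def fields_dxinv)

lemma bc_fields: "\<omega> \<in> field_vecs C \<Longrightarrow> bc_coeff C \<alpha> \<omega> n \<in> field_vecs C"
proof (induction n)
  case 0
  then show ?case
    using fields_scale[where z = "- \<alpha>"]
    by (cases \<omega>) (simp add: field_vecs_iff vmap_def fields_dxinv fields_scale cst_uminus)
qed (simp add: L2_fields vmap2_dxinv_fields)

lemma b_fields: "\<omega> \<in> field_vecs C \<Longrightarrow> b_coeff C \<alpha> \<omega> n $ j \<in> flds C"
  and c_fields: "\<omega> \<in> field_vecs C \<Longrightarrow> c_coeff C \<alpha> \<omega> n $ j \<in> flds C"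
  using bc_fields[of \<omega> \<alpha> n] by (simp_all add: field_vecs_def b_coeff_def c_coeff_def)

lemma a_Suc_integrand:
  "(q, r) \<in> field_vecs C \<Longrightarrow>
    vdot r (b_coeff C \<alpha> (q, r) n) - vdot (c_coeff C \<alpha> (q, r) n) q \<in> flds C"
  using b_fields[of "(q, r)" \<alpha> n] c_fields[of "(q, r)" \<alpha> n]
  by (simp add: vdot_def field_vecs_iff fields_diff fields_sum fields_mult)

lemma d_Suc_integrand:
  "(q, r) \<in> field_vecs C \<Longrightarrow>
    q $ j * c_coeff C \<alpha> (q, r) n $ k - b_coeff C \<alpha> (q, r) n $ j * r $ k \<in> flds C"
  using b_fields[of "(q, r)" \<alpha> n] c_fields[of "(q, r)" \<alpha> n]
  by (simp add: field_vecs_iff fields_diff fields_mult)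

lemma dx_a: "(q, r) \<in> field_vecs C \<Longrightarrow>
    dx C (a_coeff C \<alpha> (q, r) (Suc n)) = vdot r (b_coeff C \<alpha> (q, r) n) - vdot (c_coeff C \<alpha> (q, r) n) q"
  by (simp add: a_Suc_integrand dx_dxinv)

lemma dx_d: "(q, r) \<in> field_vecs C \<Longrightarrow>
    dx C (d_coeff C \<alpha> (q, r) (Suc n) $ j $ k) =
      q $ j * c_coeff C \<alpha> (q, r) n $ k - b_coeff C \<alpha> (q, r) n $ j * r $ k"
  by (simp add: d_Suc_integrand dx_dxinv)

text \<open>The nonlocal terms of \<open>L2\<close> are regrouped: those with the factor
  \<open>q $ j\<close> or \<open>r $ j\<close> outside the integral assemble to
  \<open>a_coeff\<close>, the remaining ones to \<open>d_coeff\<close>, both of index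
  \<open>Suc n\<close>. This turns the recursion into the off-diagonal part of the Lax
  equation.\<close>

lemma dx_bc_Suc:
  assumes "(q, r) \<in> field_vecs C"
  shows "dx C (b_coeff C \<alpha> (q, r) (Suc n) $ j) =
      q $ j * a_coeff C \<alpha> (q, r) (Suc n) - (\<Sum>k\<in>UNIV. q $ k * d_coeff C \<alpha> (q, r) (Suc n) $ j $ k)
        - 2 * cst C \<i> * b_coeff C \<alpha> (q, r) n $ j" (is ?b)
    and "dx C (c_coeff C \<alpha> (q, r) (Suc n) $ j) =
      2 * cst C \<i> * c_coeff C \<alpha> (q, r) n $ j
        + ((\<Sum>k\<in>UNIV. r $ k * d_coeff C \<alpha> (q, r) (Suc n) $ k $ j) - r $ j * a_coeff C \<alpha> (q, r) (Suc n))" (is ?c)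
proof -
  define b where "b = b_coeff C \<alpha> (q, r) n"
  define c where "c = c_coeff C \<alpha> (q, r) n"
  have bc: "bc_coeff C \<alpha> (q, r) n = (b, c)"
    by (simp add: b_def c_def b_coeff_def c_coeff_def)
  have flds [simp]: "q $ j \<in> flds C" "r $ j \<in> flds C" "b $ j \<in> flds C" "c $ j \<in> flds C" for j
    using assms b_fields[OF assms] c_fields[OF assms] by (simp_all add: field_vecs_iff b_def c_def)
  have L2: "L2 C (q, r) (b, c) \<in> field_vecs C"
    by (rule L2_fields[OF assms]) (simp add: field_vecs_iff)
  have a: "a_coeff C \<alpha> (q, r) (Suc n) =
      (\<Sum>k\<in>UNIV. dxinv C (r $ k * b $ k)) - (\<Sum>k\<in>UNIV. dxinv C (q $ k * c $ k))"
    by (simp add: b_def[symmetric] c_def[symmetric] vdot_def dxinv_diff dxinv_sum fields_sum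
        fields_mult mult.commute)
  have d: "d_coeff C \<alpha> (q, r) (Suc n) $ j $ k = dxinv C (q $ j * c $ k) - dxinv C (r $ k * b $ j)" for j k
    by (simp add: b_def[symmetric] c_def[symmetric] dxinv_diff fields_mult mult.commute)
  have two: "cst C (2 * \<i>) = 2 * cst C \<i>" "cst C (- (2 * \<i>)) = - (2 * cst C \<i>)"
    using cst_add[of \<i> \<i>] by (simp_all add: cst_uminus)
  have "dx C (b_coeff C \<alpha> (q, r) (Suc n) $ j) = fst (L2 C (q, r) (b, c)) $ j"
       "dx C (c_coeff C \<alpha> (q, r) (Suc n) $ j) = snd (L2 C (q, r) (b, c)) $ j"
    using L2 unfolding b_coeff_def c_coeff_def bc_coeff.simps bc
    by (simp_all add: field_vecs_def vmap2_def vmap_def dx_dxinv del: L2.simps)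
  then show ?b ?c
    unfolding a d b_def[symmetric] c_def[symmetric] L2.simps mult_minus_left two
    by (simp_all add: algebra_simps sum_distrib_left sum_subtractf sum.distrib)
qed

text \<open>The initial values fit the same pattern without the term of index \<open>n - 1\<close>:
  the diagonal values \<open>\<alpha> / 2\<close> and \<open>- \<alpha> / 2\<close> combine to the
  factor \<open>\<alpha>\<close> of the definition.\<close>

lemma dx_bc_0:
  assumes "(q, r) \<in> field_vecs C"
  shows "dx C (b_coeff C \<alpha> (q, r) 0 $ j) =
      q $ j * a_coeff C \<alpha> (q, r) 0 - (\<Sum>k\<in>UNIV. q $ k * d_coeff C \<alpha> (q, r) 0 $ j $ k)"
    and "dx C (c_coeff C \<alpha> (q, r) 0 $ j) =
      (\<Sum>k\<in>UNIV. r $ k * d_coeff C \<alpha> (q, r) 0 $ k $ j) - r $ j * a_coeff C \<alpha> (q, r) 0"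
proof -
  have [simp]: "q $ j \<in> flds C" "r $ j \<in> flds C" for j
    using assms by (simp_all add: field_vecs_iff)
  have \<alpha>: "cst C \<alpha> = 2 * cst C (\<alpha> / 2)"
    using cst_add[of "\<alpha> / 2" "\<alpha> / 2"] by simp
  have "dx C (b_coeff C \<alpha> (q, r) 0 $ j) = cst C \<alpha> * q $ j"
    by (simp add: b_coeff_def vmap_def dx_dxinv fields_scale)
  moreover have "dx C (c_coeff C \<alpha> (q, r) 0 $ j) = - (cst C \<alpha> * r $ j)"
    by (simp add: c_coeff_def vmap_def dx_dxinv fields_scale fields_uminus)
  ultimately show "dx C (b_coeff C \<alpha> (q, r) 0 $ j) =
      q $ j * a_coeff C \<alpha> (q, r) 0 - (\<Sum>k\<in>UNIV. q $ k * d_coeff C \<alpha> (q, r) 0 $ j $ k)"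
    "dx C (c_coeff C \<alpha> (q, r) 0 $ j) =
      (\<Sum>k\<in>UNIV. r $ k * d_coeff C \<alpha> (q, r) 0 $ k $ j) - r $ j * a_coeff C \<alpha> (q, r) 0"
    by (simp_all add: mat_def cst_uminus \<alpha> if_distrib if_distribR algebra_simps cong: if_cong)
qed

end

section \<open>The Lax pair over power series in the inverse spectral parameter\<close>

definition even_fps :: "(nat \<Rightarrow> 'a::zero) \<Rightarrow> 'a fps" where
  "even_fps f = Abs_fps (\<lambda>k. if even k then f (k div 2) else 0)"

definition odd_fps :: "(nat \<Rightarrow> 'a::zero) \<Rightarrow> 'a fps" where
  "odd_fps f = Abs_fps (\<lambda>k. if odd k then f (k div 2) else 0)"

lemma even_fps_nth [simp]: "fps_nth (even_fps f) k = (if even k then f (k div 2) else 0)"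
  by (simp add: even_fps_def)

lemma odd_fps_nth [simp]: "fps_nth (odd_fps f) k = (if odd k then f (k div 2) else 0)"
  by (simp add: odd_fps_def)

lemma fps_map_parity:
  "h 0 = 0 \<Longrightarrow> fps_map h (even_fps f) = even_fps (\<lambda>n. h (f n))"
  "h 0 = 0 \<Longrightarrow> fps_map h (odd_fps f) = odd_fps (\<lambda>n. h (f n))"
  by (simp_all add: fps_eq_iff)

lemma parity_fps_diff:
  "even_fps f - even_fps g = even_fps (\<lambda>n. f n - g n :: 'a::comm_ring_1)"
  "odd_fps f - odd_fps g = odd_fps (\<lambda>n. f n - g n :: 'a::comm_ring_1)"
  by (simp_all add: fps_eq_iff)

lemma parity_fps_add:
  "even_fps f + even_fps g = even_fps (\<lambda>n. f n + g n :: 'a::comm_ring_1)"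
  "odd_fps f + odd_fps g = odd_fps (\<lambda>n. f n + g n :: 'a::comm_ring_1)"
  by (simp_all add: fps_eq_iff)

lemma parity_fps_sum:
  "(\<Sum>i\<in>A. even_fps (f i)) = even_fps (\<lambda>n. \<Sum>i\<in>A. f i n :: 'a::comm_ring_1)"
  "(\<Sum>i\<in>A. odd_fps (f i)) = odd_fps (\<lambda>n. \<Sum>i\<in>A. f i n :: 'a::comm_ring_1)"
  by (simp_all add: fps_eq_iff fps_sum_nth)

lemma fps_X_const_mult_nth:
  "fps_nth (fps_X * fps_const f * F) k = (if k = 0 then 0 else f * fps_nth F (k - 1) :: 'a::comm_ring_1)"
  "fps_nth (fps_const f * fps_X\<^sup>2 * F) k = (if k < 2 then 0 else f * fps_nth F (k - 2) :: 'a::comm_ring_1)"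
  by (simp_all add: mult.assoc fps_X_power_mult_nth)

text \<open>One factor \<open>fps_X\<close> takes an even series to an odd one with the same index,
  but an odd series to an even one with the index raised by one. The raised index is written with
  \<open>case_nat 0\<close>, which supplies zero for the coefficient of index -1.\<close>

lemma fps_X_const_mult_parity:
  fixes f :: "'a::comm_ring_1"
  shows "fps_X * fps_const f * even_fps g = odd_fps (\<lambda>n. f * g n)"
    and "fps_X * fps_const f * odd_fps g = even_fps (case_nat 0 (\<lambda>n. f * g n))"
    and "fps_const f * fps_X\<^sup>2 * odd_fps g = odd_fps (case_nat 0 (\<lambda>n. f * g n))"
proof -
  show "fps_X * fps_const f * even_fps g = odd_fps (\<lambda>n. f * g n)"
    by (rule fps_ext) (auto simp: fps_X_const_mult_nth elim!: oddE)
  show "fps_X * fps_const f * odd_fps g = even_fps (case_nat 0 (\<lambda>n. f * g n))"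
  proof (rule fps_ext)
    fix k
    show "fps_nth (fps_X * fps_const f * odd_fps g) k = fps_nth (even_fps (case_nat 0 (\<lambda>n. f * g n))) k"
    proof (cases k)
      case (Suc m)
      then show ?thesis
        unfolding fps_X_const_mult_nth by (auto elim!: oddE evenE)
    qed (simp add: fps_X_const_mult_nth)
  qed
  show "fps_const f * fps_X\<^sup>2 * odd_fps g = odd_fps (case_nat 0 (\<lambda>n. f * g n))"
  proof (rule fps_ext)
    fix k
    show "fps_nth (fps_const f * fps_X\<^sup>2 * odd_fps g) k = fps_nth (odd_fps (case_nat 0 (\<lambda>n. f * g n))) k"
    proof (cases "k < 2")
      case True
      then show ?thesis
        unfolding fps_X_const_mult_nth by (auto elim!: oddE)
    next
      case False
      then obtain m where "k = Suc (Suc m)"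
        by (metis add_2_eq_Suc le_Suc_ex not_less)
      then show ?thesis
        unfolding fps_X_const_mult_nth by auto
    qed
  qed
qed

text \<open>\<open>U\<close> and \<open>W\<close> contain no positive power of \<lambda>, so the
  calculations take place in power series in \<zeta>, represented by \<open>fps_X\<close>, where
  \<open>fps_deriv\<close> serves as the \<zeta>-derivative. The Laurent matrices return only for
  the zero-curvature equation and the final statement.\<close>

definition U_fps :: "'a::comm_ring_1 calculus \<Rightarrow> ('a, 'n::finite) vec2 \<Rightarrow> ('a fps, 'n) bmat" where
  "U_fps C \<omega> = block (fps_const (cst C \<i>) * fps_X\<^sup>2) (vmap (\<lambda>f. fps_X * fps_const f) (snd \<omega>))
     (vmap (\<lambda>f. fps_X * fps_const f) (fst \<omega>)) (mat (- (fps_const (cst C \<i>) * fps_X\<^sup>2)))"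

definition W_fps :: "'a::comm_ring_1 calculus \<Rightarrow> complex \<Rightarrow> ('a, 'n::finite) vec2 \<Rightarrow> ('a fps, 'n) bmat" where
  "W_fps C \<alpha> \<omega> = block (even_fps (a_coeff C \<alpha> \<omega>)) (\<chi> j. odd_fps (\<lambda>n. c_coeff C \<alpha> \<omega> n $ j))
     (\<chi> j. odd_fps (\<lambda>n. b_coeff C \<alpha> \<omega> n $ j)) (\<chi> j k. even_fps (\<lambda>n. d_coeff C \<alpha> \<omega> n $ j $ k))"

context spatial_calculus
begin

text \<open>The Lax equation, compared block by block and order by order, is exactly the recursion
  in its local form.\<close>

lemma W_fps_lax:
  assumes "\<omega> \<in> field_vecs C"
  shows "mmap (fps_map (dx C)) (W_fps C \<alpha> \<omega>) = comm (U_fps C \<omega>) (W_fps C \<alpha> \<omega>)"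
proof -
  obtain q r where \<omega>: "\<omega> = (q, r)" by (cases \<omega>)
  note qr = assms[unfolded \<omega>]
  define a where "a = a_coeff C \<alpha> (q, r)"
  define b where "b = b_coeff C \<alpha> (q, r)"
  define c where "c = c_coeff C \<alpha> (q, r)"
  define d where "d = d_coeff C \<alpha> (q, r)"
  \<comment> \<open>The \<open>case_nat\<close> form treats the initial coefficients and the
    recursion uniformly and matches the shifts in \<open>fps_X_const_mult_parity\<close>.\<close>
  have a: "dx C (a n) = (\<Sum>k\<in>UNIV. case_nat 0 (\<lambda>n. r $ k * b n $ k) n)
      - (\<Sum>k\<in>UNIV. case_nat 0 (\<lambda>n. q $ k * c n $ k) n)" for n
    using dx_a[OF qr, of \<alpha>]
    by (cases n) (simp_all add: a_def b_def c_def vdot_def mult.commute del: a_coeff.simps(2))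
  have d: "dx C (d n $ j $ k) = case_nat 0 (\<lambda>n. q $ j * c n $ k) n
      - case_nat 0 (\<lambda>n. r $ k * b n $ j) n" for j k n
    using dx_d[OF qr, of \<alpha>]
    by (cases n) (simp_all add: d_def b_def c_def mat_def mult.commute del: d_coeff.simps(2))
  have b: "dx C (b n $ j) = q $ j * a n - (\<Sum>k\<in>UNIV. q $ k * d n $ j $ k)
      - (case_nat 0 (\<lambda>n. cst C \<i> * b n $ j) n + case_nat 0 (\<lambda>n. cst C \<i> * b n $ j) n)" for j n
    using dx_bc_0(1)[OF qr, of \<alpha>] dx_bc_Suc(1)[OF qr, of \<alpha>]
    by (cases n) (simp_all add: a_def b_def d_def algebra_simps)
  have c: "dx C (c n $ j) = case_nat 0 (\<lambda>n. cst C \<i> * c n $ j) n + case_nat 0 (\<lambda>n. cst C \<i> * c n $ j) n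
      + ((\<Sum>k\<in>UNIV. r $ k * d n $ k $ j) - r $ j * a n)" for j n
    using dx_bc_0(2)[OF qr, of \<alpha>] dx_bc_Suc(2)[OF qr, of \<alpha>]
    by (cases n) (simp_all add: a_def c_def d_def algebra_simps)
  have two: "2 * u * f = u * f + u * f" for u f :: "'a fps"
    by (simp add: algebra_simps)
  \<comment> \<open>Moves the monomial to the front, where the parity rules expect it.\<close>
  have ac: "odd_fps (\<lambda>n. c n $ k) * (fps_X * fps_const g) = fps_X * fps_const g * odd_fps (\<lambda>n. c n $ k)"
    "odd_fps (\<lambda>n. b n $ k) * (fps_X * fps_const g) = fps_X * fps_const g * odd_fps (\<lambda>n. b n $ k)" for g k
    by (rule mult.commute)+
  show ?thesis
    unfolding W_fps_def U_fps_def comm_block mmap_block \<omega>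
    unfolding a_def[symmetric] b_def[symmetric] c_def[symmetric] d_def[symmetric] fst_conv snd_conv
    unfolding bmat_eq_iff block_nth vmap_def mmap_nth vec_lambda_beta vdot_def two
      fps_map_parity[where h = "dx C", OF dx.zero]
    unfolding a b c d ac fps_X_const_mult_parity parity_fps_sum parity_fps_diff parity_fps_add
    by simp
qed

text \<open>Constants enter only through the initial values of \<open>a_coeff\<close> and
  \<open>d_coeff\<close>, which sit at order zero.\<close>

lemma W_fps_coeff_series:
  assumes "\<omega> \<in> field_vecs C"
  shows "W_fps C \<alpha> \<omega> $ i $ j \<in> coeff_series"
proof -
  obtain q r where \<omega>: "\<omega> = (q, r)" by (cases \<omega>)
  note qr = assms[unfolded \<omega>]
  have 0: "0 \<in> range (cst C)"
    by (rule range_eqI[of _ _ 0]) simp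
  have "(if j = k then cst C (- (\<alpha> / 2)) else 0) \<in> range (cst C)" for j k :: 'n
    using 0 by auto
  moreover have "a_coeff C \<alpha> (q, r) m \<in> flds C" if "m > 0" for m
    using that a_Suc_integrand[OF qr, of \<alpha>] by (cases m) (simp_all add: fields_dxinv)
  moreover have "d_coeff C \<alpha> (q, r) m $ j $ k \<in> flds C" if "m > 0" for m j k
    using that d_Suc_integrand[OF qr, of _ \<alpha>] by (cases m) (simp_all add: fields_dxinv)
  moreover have "k > 0 \<Longrightarrow> even k \<Longrightarrow> k div 2 > 0" for k :: nat
    by auto
  ultimately show ?thesis
    using 0 b_fields[OF assms, of \<alpha>] c_fields[OF assms, of \<alpha>] unfolding \<omega>
    by (cases i; cases j) (auto simp: W_fps_def coeff_series_def mat_def)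
qed

lemma U_fps_nth_0: "fps_nth (U_fps C \<omega> $ i $ j) 0 = 0"
  by (cases i; cases j) (simp_all add: U_fps_def vmap_def mat_def)

lemma W_fps_square:
  assumes "\<omega> \<in> field_vecs C"
  shows "W_fps C \<alpha> \<omega> ** W_fps C \<alpha> \<omega> = mat (fps_const (cst C (\<alpha>\<^sup>2 / 4)))"
proof -
  define W where "W = W_fps C \<alpha> \<omega>"
  define U where "U = U_fps C \<omega>"
  define M :: "('a fps, 'b) bmat" where "M = mat (fps_const (cst C (\<alpha>\<^sup>2 / 4)))"
  have W: "W $ i $ j \<in> coeff_series" for i j
    by (simp add: W_def W_fps_coeff_series assms)
  interpret X: derivation "fps_map (dx C)"
    by (rule derivation_fps_map) (rule derivation_dx)
  have Wx: "mmap (fps_map (dx C)) W = comm U W"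
    by (simp add: W_def U_def W_fps_lax assms)
  have "mmap (fps_map (dx C)) (W ** W) = comm U (W ** W)"
    unfolding X.matrix_mult Wx
    by (simp add: comm_def matrix_diff_ldistrib matrix_diff_rdistrib matrix_mul_assoc)
  moreover have "mmap (fps_map (dx C)) M = 0"
    by (simp add: M_def vec_eq_iff mat_def fps_eq_iff)
  moreover have "comm U M = 0"
    by (simp add: comm_def M_def mat_mult_left mat_mult_right)
  ultimately have Yx: "mmap (fps_map (dx C)) (W ** W - M) = comm U (W ** W - M)"
    by (simp add: X.matrix_diff comm_def matrix_diff_ldistrib matrix_diff_rdistrib)
  have W0: "fps_nth (W $ i $ j) 0 = (if i = j then if i = None then cst C (\<alpha> / 2) else - cst C (\<alpha> / 2) else 0)"
    for i j
    by (cases i; cases j; cases \<omega>) (simp_all add: W_def W_fps_def mat_def cst_uminus)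
  have sq: "cst C (\<alpha> / 2) * cst C (\<alpha> / 2) = cst C (\<alpha>\<^sup>2 / 4)"
    by (simp add: cst_mult[symmetric] power2_eq_square)
  \<comment> \<open>At order zero \<open>W\<close> is \<open>\<alpha> / 2\<close> times
    \<open>sigma3\<close>, whose square is the scalar subtracted here. The difference is thereby
    free of constants, as the uniqueness lemma requires.\<close>
  have Y0: "fps_nth ((W ** W - M) $ i $ j) 0 = 0" for i j
    by (cases i; cases j)
      (simp_all add: matrix_matrix_mult_def fps_sum_nth W0 M_def mat_def sum_option_UNIV sq
        if_distrib if_distribR cong: if_cong)
  have "(W ** W - M) $ i $ j \<in> fld_series" for i j
  proof -
    have "fps_nth ((W ** W - M) $ i $ j) k \<in> flds C" for k
    proof (cases "k = 0")
      case True
      then show ?thesis using Y0 by simp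
    next
      case False
      have "(W ** W) $ i $ j \<in> coeff_series"
        by (simp add: matrix_matrix_mult_def coeff_series_sum coeff_series_mult W)
      then show ?thesis
        using False by (cases "i = j") (simp_all add: coeff_series_def M_def mat_def)
    qed
    then show ?thesis by (simp add: fld_series_def)
  qed
  then have "W ** W - M = 0"
    using lax_solution_unique U_fps_nth_0 Yx unfolding U_def by blast
  then show ?thesis by (simp add: W_def M_def)
qed

section \<open>The Hamiltonian densities and their variation\<close>

definition density :: "complex \<Rightarrow> nat \<Rightarrow> ('a, 'n::finite) vec2 \<Rightarrow> 'a" where
  "density \<alpha> n \<omega> = cst C (2 * \<i>) * (a_coeff C \<alpha> \<omega> n - trace (d_coeff C \<alpha> \<omega> n))
     + vdot (c_coeff C \<alpha> \<omega> n) (fst \<omega>) + vdot (snd \<omega>) (b_coeff C \<alpha> \<omega> n)"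

lemma hamiltonian_eq:
  "hamiltonian C \<alpha> n \<omega> t = intg C (density \<alpha> n \<omega>) t / (2 * (of_nat n + 1))"
  by (cases \<omega>) (simp add: density_def intg_scale)

text \<open>The \<zeta>-derivative of \<open>U\<close> is 2 i \<zeta> \<open>sigma3\<close> +
  \<open>Q\<close>. At order \<open>2 * n + 1\<close> the first part meets the diagonal blocks of
  \<open>W\<close> at order \<open>2 * n\<close>, the second the off-diagonal ones at order
  \<open>2 * n + 1\<close>.\<close>

lemma density_eq_trace:
  "density \<alpha> n \<omega> =
    fps_nth (trace (mmap fps_deriv (U_fps C \<omega>) ** W_fps C \<alpha> \<omega>)) (2 * n + 1)"
proof -
  obtain q r where \<omega>: "\<omega> = (q, r)" by (cases \<omega>)
  have cc: "cst C (2 * \<i>) = 2 * cst C \<i>"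
    using cst_add[of \<i> \<i>] by simp
  have m: "mmap fps_deriv (mat x) = (mat (fps_deriv x) :: 'a fps ^ 'b ^ 'b)" for x
    by (simp add: vec_eq_iff mat_def)
  have d: "fps_deriv (fps_const u * fps_X\<^sup>2) = fps_const (2 * u) * fps_X" for u :: 'a
    by (simp add: fps_eq_iff fps_X_power_nth fps_X_nth le_Suc_eq mult.commute)
  have tr: "trace (\<chi> j k. f j k + (mat x ** A) $ j $ k) = (\<Sum>j\<in>UNIV. f j j) + x * trace A"
    for x f and A :: "'a fps ^ 'b ^ 'b"
    by (simp add: trace_def mat_mult_left sum.distrib sum_distrib_left)
  have td: "fps_nth (trace (\<chi> j k. even_fps (\<lambda>n. d n $ j $ k))) (2 * n) = trace (d n)"
    for d :: "nat \<Rightarrow> 'a ^ 'b ^ 'b"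
    by (simp add: trace_def fps_sum_nth)
  show ?thesis
    unfolding \<omega> density_def U_fps_def W_fps_def mmap_block block_mult trace_block m fps_deriv_neg d tr cc
    by (simp add: vdot_def vmap_def fps_sum_nth mult.assoc td; simp add: algebra_simps)
qed

text \<open>The trace identity, integrated and read at order \<open>2 * n + 1\<close>. The
  \<zeta>-derivative there contributes the factor \<open>2 * n + 2\<close>, which the normalisation
  of the Hamiltonian compensates. For \<open>\<alpha> = 0\<close> the scalar in the identity cannot
  be divided out, so that case is separate.\<close>

theorem variation_identity:
  assumes \<delta>: "derivation \<delta>" and dx_\<delta>: "\<And>f. dx C (\<delta> f) = \<delta> (dx C f)"
    and \<delta>_cst: "\<And>z. \<delta> (cst C z) = 0" and \<delta>_fields: "\<And>f. f \<in> flds C \<Longrightarrow> \<delta> f \<in> flds C"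
    and \<omega>: "\<omega> \<in> field_vecs C"
  shows "intg C (\<delta> (density \<alpha> n \<omega>)) t = 2 * (of_nat n + 1) *
    intg C (vdot2 (vmap2 \<delta> \<omega>) (c_coeff C \<alpha> \<omega> n, b_coeff C \<alpha> \<omega> n)) t"
proof (cases "\<alpha> = 0")
  case False
  define W where "W = W_fps C \<alpha> \<omega>"
  define U where "U = U_fps C \<omega>"
  define X where "X = fps_map (dx C)"
  define E where "E = fps_map \<delta>"
  define Z where "Z = (fps_deriv :: 'a fps \<Rightarrow> 'a fps)"
  define R where "R = trace (mmap Z U ** mmap E W) - trace (mmap E U ** mmap Z W)"
  interpret d: derivation \<delta> by fact
  interpret X: derivation X
    unfolding X_def by (rule derivation_fps_map) (rule derivation_dx)
  interpret E: derivation E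
    unfolding E_def by (rule derivation_fps_map) (rule \<delta>)
  interpret Z: derivation Z
    unfolding Z_def by (rule derivation_fps_deriv)
  have XE: "X (E F) = E (X F)" for F
    by (simp add: X_def E_def fps_eq_iff dx_\<delta>)
  have XZ: "X (Z F) = Z (X F)" for F
    by (simp add: X_def Z_def fps_map_deriv_commute derivation_dx)
  have EZ: "mmap E (mmap Z U) = mmap Z (mmap E U)"
    by (simp add: E_def Z_def vec_eq_iff fps_map_deriv_commute \<delta>)
  have id: "X (trace (W ** mmap E W ** mmap Z W)) = 2 * fps_const (cst C (\<alpha>\<^sup>2 / 4)) * R"
    unfolding R_def
  proof (rule trace_identity[OF X.derivation_axioms E.derivation_axioms Z.derivation_axioms XE XZ])
    show "mmap X W = comm U W"
      by (simp add: X_def W_def U_def W_fps_lax \<omega>)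
    show "W ** W = mat (fps_const (cst C (\<alpha>\<^sup>2 / 4)))"
      by (simp add: W_def W_fps_square \<omega>)
  qed (simp_all add: E_def Z_def fps_eq_iff \<delta>_cst)
  have W: "W $ i $ j \<in> coeff_series" for i j
    by (simp add: W_def W_fps_coeff_series \<omega>)
  \<comment> \<open>\<open>W\<close> itself has constants at order zero, but \<delta> kills them and
    the \<zeta>-derivative drops them. Both derivatives therefore have field coefficients.\<close>
  have EW: "mmap E W $ i $ j \<in> fld_series" for i j
    unfolding fld_series_def
  proof (rule CollectI, rule allI)
    fix k
    show "fps_nth (mmap E W $ i $ j) k \<in> flds C"
      using coeff_series_nth[OF W, of i j k] by (auto simp: E_def \<delta>_fields \<delta>_cst)
  qed
  have ZW: "mmap Z W $ i $ j \<in> fld_series" for i j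
  proof -
    have "of_nat k * f \<in> flds C" if "f \<in> flds C" for k f
      using fields_scale[OF that, of "of_nat k"] by (simp add: cst_of_nat)
    from this[of _ "Suc _"] show ?thesis
      using W[of i j] by (simp add: fld_series_def coeff_series_def Z_def)
  qed
  have intg_R: "intg C (fps_nth R m) t = 0" for m
  proof -
    have two: "2 * cst C (\<alpha>\<^sup>2 / 4) = cst C (\<alpha>\<^sup>2 / 2)"
      using cst_add[of "\<alpha>\<^sup>2 / 4" "\<alpha>\<^sup>2 / 4"] by simp
    have "2 * fps_const (cst C (\<alpha>\<^sup>2 / 4)) = fps_const (2 * cst C (\<alpha>\<^sup>2 / 4))"
      by (metis fps_const_mult fps_numeral_fps_const)
    then have "cst C (\<alpha>\<^sup>2 / 2) * fps_nth R m = fps_nth (X (trace (W ** mmap E W ** mmap Z W))) m"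
      by (simp only: id two fps_mult_left_const_nth)
    also have "\<dots> = (\<Sum>i\<in>UNIV. \<Sum>k\<in>UNIV. dx C (fps_nth ((W ** mmap E W) $ i $ k * mmap Z W $ k $ i) m))"
      by (simp add: X_def trace_def matrix_matrix_mult_def[of _ "mmap Z W"] fps_sum_nth dx.sum
          del: mmap_nth)
    finally have "intg C (cst C (\<alpha>\<^sup>2 / 2) * fps_nth R m) t =
      (\<Sum>i\<in>UNIV. \<Sum>k\<in>UNIV. intg C (dx C (fps_nth ((W ** mmap E W) $ i $ k * mmap Z W $ k $ i) m)) t)"
      by (simp only: intg_sum)
    \<comment> \<open>Grouped as \<open>W ** mmap E W\<close> against \<open>mmap Z W\<close>, each
      summand is the derivative of a product of two series with field coefficients.\<close>
    also have "\<dots> = 0"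
    proof (intro sum.neutral ballI intg_dx_fld_series_mult ZW)
      fix i k
      show "(W ** mmap E W) $ i $ k \<in> fld_series"
        using fld_series_sum[of UNIV "\<lambda>l. W $ i $ l * mmap E W $ l $ k"] fld_series_mult[OF W EW]
        by (simp add: matrix_matrix_mult_def del: mmap_nth)
    qed
    finally show ?thesis using False by (simp add: intg_scale)
  qed
  \<comment> \<open>The terms with the mixed second derivative of \<open>U\<close> cancel because
    \<open>E\<close> and \<open>Z\<close> commute.\<close>
  have "E (trace (mmap Z U ** W)) - Z (trace (mmap E U ** W)) = R"
    unfolding R_def E.trace[symmetric] Z.trace[symmetric] E.matrix_mult Z.matrix_mult EZ
    by (simp add: trace_add)
  from arg_cong[OF this, of "\<lambda>F. fps_nth F (2 * n + 1)"]
  have "\<delta> (density \<alpha> n \<omega>) - of_nat (2 * n + 2) * fps_nth (trace (mmap E U ** W)) (2 * n + 2)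
      = fps_nth R (2 * n + 1)"
    unfolding density_eq_trace by (simp add: E_def Z_def U_def W_def)
  then have "\<delta> (density \<alpha> n \<omega>) = fps_nth R (2 * n + 1)
      + cst C (of_nat (2 * n + 2)) * fps_nth (trace (mmap E U ** W)) (2 * n + 2)"
    unfolding cst_of_nat by (simp add: diff_eq_eq)
  \<comment> \<open>Only the part \<zeta> \<open>Q\<close> of \<open>U\<close> varies, so order
    \<open>2 * n + 2\<close> selects the off-diagonal coefficients of \<open>W\<close> at order
    \<open>2 * n + 1\<close>, those of index \<open>n\<close>.\<close>
  moreover have "fps_nth (trace (mmap E U ** W)) (2 * n + 2) =
      vdot2 (vmap2 \<delta> \<omega>) (c_coeff C \<alpha> \<omega> n, b_coeff C \<alpha> \<omega> n)"
  proof -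
    have E0: "E (fps_const (cst C \<i>) * fps_X\<^sup>2) = 0"
      by (simp add: E_def fps_eq_iff fps_X_power_nth \<delta>_cst)
    have m: "mmap E (mat (- (fps_const (cst C \<i>) * fps_X\<^sup>2))) = (0 :: 'a fps ^ 'b ^ 'b)"
      by (simp add: vec_eq_iff mat_def E.uminus E0)
    have EX: "E (fps_X * fps_const f) = fps_X * fps_const (\<delta> f)" for f
      by (simp add: fps_eq_iff E_def)
    show ?thesis
      unfolding U_def W_def U_fps_def W_fps_def mmap_block E0 m block_mult trace_block
      by (cases \<omega>) (simp add: vdot2_def vmap2_def vdot_def vmap_def EX mult.assoc fps_sum_nth trace_def
          matrix_matrix_mult_def)
  qed
  ultimately show ?thesis
    by (simp add: intg_add intg_scale intg_R del: of_nat_add of_nat_mult) (simp add: algebra_simps)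
next
  case True
  interpret d: derivation \<delta> by fact
  obtain q r where qr: "\<omega> = (q, r)" by (cases \<omega>)
  \<comment> \<open>For \<open>\<alpha> = 0\<close> the recursion starts from zero, so both sides of
    the claim vanish.\<close>
  have "bc_coeff C 0 \<omega> m = 0" for m
  proof (induction m)
    case 0
    show ?case by (simp add: zero_prod_def vmap_def vec_eq_iff)
  next
    case (Suc m)
    then show ?case by (simp add: qr zero_prod_def vmap_def vmap2_def vec_eq_iff)
  qed
  then have bc: "b_coeff C 0 \<omega> m = 0" "c_coeff C 0 \<omega> m = 0" for m
    by (simp_all add: b_coeff_def c_coeff_def)
  have "a_coeff C 0 \<omega> n = 0"
    using bc unfolding qr by (cases n) (simp_all add: vdot_def)
  moreover have "d_coeff C 0 \<omega> n = 0"
    using bc unfolding qr by (cases n) (simp_all add: vec_eq_iff mat_def)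
  ultimately show ?thesis
    using bc by (simp add: True density_def vdot2_def vdot_def trace_def)
qed

end

section \<open>Polynomial deformations\<close>

text \<open>The functional \<open>H\<^sub>n\<close> along the line \<open>\<omega> + \<epsilon> \<eta>\<close> is the evaluation at \<open>\<epsilon>\<close> of its analogue over
  polynomials in \<open>\<epsilon>\<close>; the integral is that of the value at \<open>\<epsilon> = 0\<close>.\<close>

definition poly_calculus :: "'a::comm_ring_1 calculus \<Rightarrow> 'a poly calculus" where
  "poly_calculus C = \<lparr>cst = (\<lambda>z. [:cst C z:]), dx = map_poly (dx C), dt = map_poly (dt C),
     flds = {p. \<forall>i. coeff p i \<in> flds C}, dxinv = map_poly (dxinv C),
     intg = (\<lambda>p. intg C (coeff p 0))\<rparr>"

text \<open>\<open>pderiv\<close> is only available over rings without zero divisors.\<close>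

definition poly_deriv :: "'a::comm_ring_1 poly \<Rightarrow> 'a poly" where
  "poly_deriv p = Abs_poly (\<lambda>i. of_nat (Suc i) * coeff p (Suc i))"

lemma coeff_poly_deriv [simp]: "coeff (poly_deriv p) i = of_nat (Suc i) * coeff p (Suc i)"
proof -
  have "\<forall>\<^sub>\<infinity>i. of_nat (Suc i) * coeff p (Suc i) = 0"
    using MOST_coeff_eq_0[of p] unfolding MOST_nat by (metis less_SucI mult_zero_right)
  then show ?thesis
    unfolding poly_deriv_def by (simp only: Abs_poly_inverse mem_Collect_eq)
qed

lemma derivation_poly_deriv: "derivation (poly_deriv :: 'a::comm_ring_1 poly \<Rightarrow> 'a poly)"
proof
  fix f g :: "'a poly"
  show "poly_deriv (f + g) = poly_deriv f + poly_deriv g"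
    by (simp add: poly_eq_iff algebra_simps)
  \<comment> \<open>The product rule is transferred from formal power series along the injective
    ring map \<open>fps_of_poly\<close>.\<close>
  have "fps_of_poly (poly_deriv p) = fps_deriv (fps_of_poly p)" for p :: "'a poly"
    by (simp add: fps_eq_iff)
  then have "fps_of_poly (poly_deriv (f * g)) = fps_of_poly (poly_deriv f * g + f * poly_deriv g)"
    by (simp add: fps_of_poly_mult fps_of_poly_add algebra_simps)
  then show "poly_deriv (f * g) = poly_deriv f * g + f * poly_deriv g"
    by (simp add: fps_of_poly_eq_iff)
qed

context spatial_calculus
begin

lemma coeff_poly_dx [simp]: "coeff (dx (poly_calculus C) p) i = dx C (coeff p i)"
  by (simp add: poly_calculus_def coeff_map_poly)

lemma coeff_poly_dxinv [simp]: "coeff (dxinv (poly_calculus C) p) i = dxinv C (coeff p i)"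
  by (simp add: poly_calculus_def coeff_map_poly)

lemma poly_cst: "cst (poly_calculus C) z = [:cst C z:]"
  by (simp add: poly_calculus_def)

lemma poly_fields: "p \<in> flds (poly_calculus C) \<longleftrightarrow> (\<forall>i. coeff p i \<in> flds C)"
  by (simp add: poly_calculus_def)

lemma poly_intg: "intg (poly_calculus C) p t = intg C (coeff p 0) t"
  by (simp add: poly_calculus_def)

lemma spatial_poly_calculus: "spatial_calculus (poly_calculus C)"
proof
  fix f g :: "'a poly" and t
  let ?B = "poly_calculus C"
  show "dx ?B (f * g) = dx ?B f * g + f * dx ?B g"
    by (simp add: poly_eq_iff coeff_mult dx.sum dx_mult sum.distrib)
  show "f * g \<in> flds ?B" if "f \<in> flds ?B" "g \<in> flds ?B"
    using that by (simp add: poly_fields coeff_mult fields_sum fields_mult)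
  show "intg ?B (f * dx ?B g) t = - intg ?B (dx ?B f * g) t" if "f \<in> flds ?B" "g \<in> flds ?B"
    using that by (simp add: poly_intg poly_fields coeff_mult by_parts)
  show "intg ?B (f * dxinv ?B g) t = - intg ?B (dxinv ?B f * g) t" if "f \<in> flds ?B" "g \<in> flds ?B"
    using that by (simp add: poly_intg poly_fields coeff_mult dxinv_skew)
qed (simp_all add: poly_cst poly_fields poly_intg poly_eq_iff cst_add cst_mult dx_add fields_add
    fields_scale fields_dx fields_dxinv dx_dxinv dxinv_dx intg_add intg_scale coeff_pCons one_pCons
    split: nat.splits)

definition deform :: "('a, 'n::finite) vec2 \<Rightarrow> ('a, 'n) vec2 \<Rightarrow> ('a poly, 'n) vec2" where
  "deform \<omega> \<eta> = ((\<chi> j. [:fst \<omega> $ j, fst \<eta> $ j:]), (\<chi> j. [:snd \<omega> $ j, snd \<eta> $ j:]))"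

lemma deform_fields:
  "\<omega> \<in> field_vecs C \<Longrightarrow> \<eta> \<in> field_vecs C \<Longrightarrow> deform \<omega> \<eta> \<in> field_vecs (poly_calculus C)"
  by (auto simp: field_vecs_def deform_def poly_fields coeff_pCons split: nat.splits)

section \<open>Evaluation of the deformation parameter\<close>

abbreviation ev :: "complex \<Rightarrow> 'a poly \<Rightarrow> 'a" where
  "ev \<epsilon> p \<equiv> poly p (cst C \<epsilon>)"

lemma ev_deform: "vmap2 (ev \<epsilon>) (deform \<omega> \<eta>) = \<omega> + vmap2 ((*) (cst C \<epsilon>)) \<eta>"
  by (cases \<omega>; cases \<eta>) (simp add: deform_def vmap2_def vmap_def vec_eq_iff)

lemma ev_fields: "p \<in> flds (poly_calculus C) \<Longrightarrow> ev \<epsilon> p \<in> flds C"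
proof (induction p)
  case (pCons a p)
  have "a \<in> flds C" "p \<in> flds (poly_calculus C)"
    using pCons.prems unfolding poly_fields by (force simp: coeff_pCons split: nat.splits)+
  then show ?case using pCons.IH by (simp add: fields_add fields_scale)
qed simp

text \<open>Evaluation at a constant is a combination of the coefficients with constant factors,
  over which \<open>dxinv\<close> is linear.\<close>

lemma ev_dxinv: "p \<in> flds (poly_calculus C) \<Longrightarrow> ev \<epsilon> (dxinv (poly_calculus C) p) = dxinv C (ev \<epsilon> p)"
proof (induction p)
  case 0
  have "dxinv (poly_calculus C) 0 = 0" by (simp add: poly_eq_iff)
  then show ?case by simp
next
  case (pCons a p)
  have ap: "a \<in> flds C" "p \<in> flds (poly_calculus C)"
    using pCons.prems unfolding poly_fields by (force simp: coeff_pCons split: nat.splits)+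
  have "dxinv (poly_calculus C) (pCons a p) = pCons (dxinv C a) (dxinv (poly_calculus C) p)"
    by (simp add: poly_eq_iff coeff_pCons split: nat.splits)
  then show ?case
    using pCons.IH ap by (simp add: dxinv_add dxinv_scale fields_scale ev_fields)
qed

text \<open>Evaluation is a ring homomorphism that commutes with \<open>dxinv\<close> on fields,
  hence it carries the whole recursion along.\<close>

lemma ev_bc:
  assumes "\<omega> \<in> field_vecs (poly_calculus C)"
  shows "bc_coeff C \<alpha> (vmap2 (ev \<epsilon>) \<omega>) n = vmap2 (ev \<epsilon>) (bc_coeff (poly_calculus C) \<alpha> \<omega> n)"
proof -
  interpret B: spatial_calculus "poly_calculus C" by (rule spatial_poly_calculus)
  obtain q r where \<omega>: "\<omega> = (q, r)" by (cases \<omega>)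
  note qr = assms[unfolded \<omega>]
  show ?thesis
  proof (induction n)
    case 0
    have "q $ j \<in> flds (poly_calculus C)" "r $ j \<in> flds (poly_calculus C)" for j
      using qr by (simp_all add: B.field_vecs_iff)
    then have "ev \<epsilon> (dxinv (poly_calculus C) (cst (poly_calculus C) \<alpha> * q $ j)) = dxinv C (cst C \<alpha> * ev \<epsilon> (q $ j))"
      "ev \<epsilon> (dxinv (poly_calculus C) (- cst (poly_calculus C) \<alpha> * r $ j)) = dxinv C (- cst C \<alpha> * ev \<epsilon> (r $ j))" for j
      by (subst ev_dxinv; simp add: poly_cst poly_fields fields_scale fields_uminus)+
    then show ?case
      by (simp add: \<omega> vmap2_def vmap_def vec_eq_iff)
  next
    case (Suc n)
    obtain b c where bc: "bc_coeff (poly_calculus C) \<alpha> \<omega> n = (b, c)"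
      by (cases "bc_coeff (poly_calculus C) \<alpha> \<omega> n")
    have flds: "q $ j \<in> flds (poly_calculus C)" "r $ j \<in> flds (poly_calculus C)"
      "b $ j \<in> flds (poly_calculus C)" "c $ j \<in> flds (poly_calculus C)" for j
      using qr B.bc_fields[OF assms, of \<alpha> n] by (simp_all add: B.field_vecs_iff bc)
    have L2: "L2 C (vmap2 (ev \<epsilon>) \<omega>) (vmap2 (ev \<epsilon>) (b, c)) = vmap2 (ev \<epsilon>) (L2 (poly_calculus C) \<omega> (b, c))"
      by (simp add: \<omega> vmap2_def vmap_def vec_eq_iff poly_sum ev_dxinv flds B.fields_mult poly_cst)
    have "L2 (poly_calculus C) \<omega> (b, c) \<in> field_vecs (poly_calculus C)"
      by (rule B.L2_fields[OF assms]) (simp add: B.field_vecs_iff flds)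
    then show ?case
      unfolding bc_coeff.simps Suc bc L2
      by (cases "L2 (poly_calculus C) \<omega> (b, c)")
        (simp add: vmap2_def vmap_def vec_eq_iff ev_dxinv B.field_vecs_iff)
  qed
qed

lemma ev_b_c:
  assumes "\<omega> \<in> field_vecs (poly_calculus C)"
  shows "b_coeff C \<alpha> (vmap2 (ev \<epsilon>) \<omega>) n $ j = ev \<epsilon> (b_coeff (poly_calculus C) \<alpha> \<omega> n $ j)"
    and "c_coeff C \<alpha> (vmap2 (ev \<epsilon>) \<omega>) n $ j = ev \<epsilon> (c_coeff (poly_calculus C) \<alpha> \<omega> n $ j)"
  unfolding b_coeff_def c_coeff_def ev_bc[OF assms] by (simp_all add: vmap2_def)

lemma ev_density:
  assumes "\<omega> \<in> field_vecs (poly_calculus C)"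
  shows "density \<alpha> n (vmap2 (ev \<epsilon>) \<omega>) =
    ev \<epsilon> (spatial_calculus.density (poly_calculus C) \<alpha> n \<omega>)"
proof -
  interpret B: spatial_calculus "poly_calculus C" by (rule spatial_poly_calculus)
  obtain q r where \<omega>: "\<omega> = (q, r)" by (cases \<omega>)
  note qr = assms[unfolded \<omega>]
  have v: "vmap2 (ev \<epsilon>) (q, r) = (vmap (ev \<epsilon>) q, vmap (ev \<epsilon>) r)" for \<epsilon>
    by (simp add: vmap2_def)
  note bc = ev_b_c[OF qr, unfolded v]
  have a: "a_coeff C \<alpha> (vmap (ev \<epsilon>) q, vmap (ev \<epsilon>) r) n = ev \<epsilon> (a_coeff (poly_calculus C) \<alpha> (q, r) n)"
  proof (cases n)
    case (Suc m)
    show ?thesis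
      unfolding Suc a_coeff.simps ev_dxinv[OF B.a_Suc_integrand[OF qr]]
      by (simp add: vdot_def bc poly_sum)
  qed (simp add: poly_cst)
  have d: "d_coeff C \<alpha> (vmap (ev \<epsilon>) q, vmap (ev \<epsilon>) r) n $ j $ k =
      ev \<epsilon> (d_coeff (poly_calculus C) \<alpha> (q, r) n $ j $ k)" for j k
  proof (cases n)
    case (Suc m)
    then show ?thesis
      by (simp add: ev_dxinv[OF B.d_Suc_integrand[OF qr]] bc)
  qed (simp add: poly_cst mat_def)
  show ?thesis
    unfolding \<omega> v density_def B.density_def
    by (simp add: a d bc vdot_def trace_def poly_sum poly_cst)
qed

text \<open>By linearity the integral of the evaluated polynomial is an ordinary complex polynomial
  in \<epsilon>. This connects the algebraic variation with the analytic derivative in the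
  definition of the variational derivative.\<close>

lemma intg_ev:
  "((\<lambda>\<epsilon>. intg C (ev \<epsilon> p) t) has_field_derivative intg C (coeff p 1) t) (at 0)"
proof -
  define P where "P = map_poly (\<lambda>f. intg C f t) p"
  have "intg C (ev \<epsilon> p) t = poly P \<epsilon>" for \<epsilon>
    unfolding P_def
  proof (induction p)
    case (pCons a p)
    have "map_poly (\<lambda>f. intg C f t) (pCons a p) = pCons (intg C a t) (map_poly (\<lambda>f. intg C f t) p)"
      by (simp add: poly_eq_iff coeff_map_poly coeff_pCons split: nat.splits)
    then show ?case using pCons.IH by (simp add: intg_add intg_scale)
  qed simp
  moreover have "(poly P has_field_derivative poly (pderiv P) 0) (at 0)"
    by (rule poly_DERIV)
  moreover have "poly (pderiv P) 0 = intg C (coeff p 1) t"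
    by (simp add: poly_0_coeff_0 coeff_pderiv P_def coeff_map_poly)
  ultimately show ?thesis by simp
qed

text \<open>\<open>variation_identity\<close> is applied over the polynomial calculus with
  d/d\<epsilon> as \<delta>. As the integral there reads the value at \<epsilon> = 0, it yields the
  coefficient of \<epsilon> in the deformed density.\<close>

theorem has_variational_derivative_hamiltonian:
  assumes \<omega>: "\<omega> \<in> field_vecs C"
  shows "has_variational_derivative C (hamiltonian C \<alpha> n) \<omega> (c_coeff C \<alpha> \<omega> n, b_coeff C \<alpha> \<omega> n)"
  unfolding has_variational_derivative_def
proof (intro conjI ballI allI)
  show "(c_coeff C \<alpha> \<omega> n, b_coeff C \<alpha> \<omega> n) \<in> field_vecs C"
    by (simp add: field_vecs_iff b_fields c_fields \<omega>)
next
  fix \<eta> :: "('a, 'b) vec2" and t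
  assume \<eta>: "\<eta> \<in> field_vecs C"
  let ?B = "poly_calculus C"
  interpret B: spatial_calculus ?B by (rule spatial_poly_calculus)
  define p where "p = deform \<omega> \<eta>"
  define G where "G = (c_coeff C \<alpha> \<omega> n, b_coeff C \<alpha> \<omega> n)"
  have p: "p \<in> field_vecs ?B"
    by (simp add: p_def deform_fields \<omega> \<eta>)
  have "intg C (coeff (B.density \<alpha> n p) 1) t = intg ?B (poly_deriv (B.density \<alpha> n p)) t"
    by (simp add: poly_intg)
  also have "\<dots> = 2 * (of_nat n + 1) *
      intg ?B (vdot2 (vmap2 poly_deriv p) (c_coeff ?B \<alpha> p n, b_coeff ?B \<alpha> p n)) t"
  proof (rule B.variation_identity[OF derivation_poly_deriv _ _ _ p])
    have of_nat: "of_nat k * f \<in> flds C" if "f \<in> flds C" for k f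
      using fields_scale[OF that, of "of_nat k"] by (simp add: cst_of_nat)
    show "dx ?B (poly_deriv f) = poly_deriv (dx ?B f)" for f
      by (simp add: poly_eq_iff dx_mult dx_add)
    show "poly_deriv (cst ?B z) = 0" for z
      by (simp add: poly_eq_iff poly_cst)
    show "poly_deriv f \<in> flds ?B" if "f \<in> flds ?B" for f
      using that of_nat[of _ "Suc _"] by (simp add: poly_fields)
  qed
  also have "intg ?B (vdot2 (vmap2 poly_deriv p) (c_coeff ?B \<alpha> p n, b_coeff ?B \<alpha> p n)) t =
      intg C (vdot2 \<eta> G) t"
  proof -
    have "vmap2 (ev 0) p = \<omega>"
      unfolding p_def ev_deform by (simp add: vmap2_def vmap_def prod_eq_iff vec_eq_iff)
    then have "coeff (b_coeff ?B \<alpha> p n $ j) 0 = b_coeff C \<alpha> \<omega> n $ j"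
      "coeff (c_coeff ?B \<alpha> p n $ j) 0 = c_coeff C \<alpha> \<omega> n $ j" for j
      using ev_b_c[OF p, of \<alpha> 0 n j] by (simp_all add: poly_0_coeff_0)
    then show ?thesis
      by (simp add: poly_intg vdot2_def vdot_def coeff_sum coeff_mult vmap2_def vmap_def G_def p_def
          deform_def)
  qed
  finally have c: "intg C (coeff (B.density \<alpha> n p) 1) t = 2 * (of_nat n + 1) * intg C (vdot2 \<eta> G) t" .
  have "2 * (of_nat n + 1) = (of_nat (2 * Suc n) :: complex)"
    by simp
  then have nz: "2 * (of_nat n + 1) \<noteq> (0 :: complex)"
    by (simp only: of_nat_eq_0_iff) simp
  have "hamiltonian C \<alpha> n (\<omega> + vmap2 ((*) (cst C \<epsilon>)) \<eta>) t =
      intg C (ev \<epsilon> (B.density \<alpha> n p)) t / (2 * (of_nat n + 1))" for \<epsilon>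
    unfolding hamiltonian_eq ev_density[OF p, symmetric] by (simp add: p_def ev_deform)
  then show "((\<lambda>\<epsilon>. hamiltonian C \<alpha> n (\<omega> + vmap2 ((*) (cst C \<epsilon>)) \<eta>) t) has_field_derivative
      intg C (vdot2 \<eta> (c_coeff C \<alpha> \<omega> n, b_coeff C \<alpha> \<omega> n)) t) (at 0)"
    using DERIV_cdivide[OF intg_ev, of "B.density \<alpha> n p" t "2 * (of_nat n + 1)"] nz
    unfolding c G_def by simp
qed

end

section \<open>Skew-symmetry\<close>

lemma vdot2_commute: "vdot2 f g = vdot2 g f"
  by (simp add: vdot2_def vdot_def mult.commute)

context spatial_calculus
begin

lemma K_fields: "\<omega> \<in> field_vecs C \<Longrightarrow> f \<in> field_vecs C \<Longrightarrow> K_op C \<omega> f \<in> field_vecs C"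
proof -
  assume \<omega>: "\<omega> \<in> field_vecs C" and f: "f \<in> field_vecs C"
  have swap: "prod.swap g \<in> field_vecs C" if "g \<in> field_vecs C" for g :: "('a, 'b) vec2"
    using that by (simp add: field_vecs_def)
  show ?thesis
    unfolding K_op_def by (intro vmap2_dxinv_fields swap L2_fields \<omega> f)
qed

text \<open>The gradient lists \<open>c\<close> before \<open>b\<close> while the recursion lists
  \<open>b\<close> before \<open>c\<close>; the two swaps in \<open>K_op\<close> reconcile the
  orders.\<close>

lemma K_bc:
  "K_op C \<omega> (c_coeff C \<alpha> \<omega> n, b_coeff C \<alpha> \<omega> n) = (c_coeff C \<alpha> \<omega> (Suc n), b_coeff C \<alpha> \<omega> (Suc n))"
  by (cases "L2 C \<omega> (bc_coeff C \<alpha> \<omega> n)")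
    (simp add: K_op_def b_coeff_def c_coeff_def vmap2_def)

lemma K_pow_bc:
  "(K_op C \<omega> ^^ n) (c_coeff C \<alpha> \<omega> 0, b_coeff C \<alpha> \<omega> 0) = (c_coeff C \<alpha> \<omega> n, b_coeff C \<alpha> \<omega> n)"
  by (induction n) (simp_all add: K_bc)

lemma J_skew: "skew_symmetric C (J_op C)"
  unfolding skew_symmetric_def
  by (auto simp: field_vecs_iff vdot2_def vdot_def J_op_def vmap2_def intg_add intg_sum by_parts
      sum_negf)

text \<open>The derivative in \<open>J_op\<close> removes the outer integration of
  \<open>K_op\<close>, and two swaps cancel. Skew-symmetry of \<open>J K\<close> thus becomes a
  statement about \<open>L2\<close>.\<close>

lemma JK: "\<omega> \<in> field_vecs C \<Longrightarrow> f \<in> field_vecs C \<Longrightarrow> J_op C (K_op C \<omega> f) = L2 C \<omega> (prod.swap f)"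
proof -
  assume \<omega>: "\<omega> \<in> field_vecs C" and f: "f \<in> field_vecs C"
  have "L2 C \<omega> (prod.swap f) \<in> field_vecs C"
    using f by (intro L2_fields \<omega>) (simp add: field_vecs_def)
  then show ?thesis
    by (cases "L2 C \<omega> (prod.swap f)")
      (simp add: J_op_def K_op_def vmap2_def vec_eq_iff field_vecs_iff dx_dxinv)
qed

lemma intg_dxinv_swap:
  "f \<in> flds C \<Longrightarrow> g \<in> flds C \<Longrightarrow> intg C (f * dxinv C g) t = - intg C (g * dxinv C f) t"
  by (subst dxinv_skew) (simp_all add: mult.commute)

lemma sum_intg_dxinv_swap:
  assumes "\<And>j k. u j k \<in> flds C" "\<And>j k. v j k \<in> flds C"
  shows "(\<Sum>j\<in>A. \<Sum>k\<in>B. intg C (u j k * dxinv C (v j k)) t) =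
      - (\<Sum>j\<in>A. \<Sum>k\<in>B. intg C (v j k * dxinv C (u j k)) t)"
    and "(\<Sum>j\<in>A. \<Sum>k\<in>B. intg C (u j k * dxinv C (v j k)) t) =
      - (\<Sum>k\<in>B. \<Sum>j\<in>A. intg C (v j k * dxinv C (u j k)) t)"
proof -
  show 1: "(\<Sum>j\<in>A. \<Sum>k\<in>B. intg C (u j k * dxinv C (v j k)) t) =
      - (\<Sum>j\<in>A. \<Sum>k\<in>B. intg C (v j k * dxinv C (u j k)) t)"
    using intg_dxinv_swap[OF assms] by (simp add: sum_negf)
  show "(\<Sum>j\<in>A. \<Sum>k\<in>B. intg C (u j k * dxinv C (v j k)) t) =
      - (\<Sum>k\<in>B. \<Sum>j\<in>A. intg C (v j k * dxinv C (u j k)) t)"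
    unfolding 1 by (subst sum.swap) (rule refl)
qed

text \<open>The local part is antisymmetric by its opposite signs. Each nonlocal double sum becomes,
  by skewness of \<open>dxinv\<close>, minus the double sum in the transposed position with
  \<open>f\<close> and \<open>g\<close> exchanged.\<close>

lemma L2_swap_skew:
  assumes \<omega>: "\<omega> \<in> field_vecs C"
  shows "skew_symmetric C (\<lambda>f. L2 C \<omega> (prod.swap f))"
  unfolding skew_symmetric_def
proof (intro ballI allI)
  fix f g :: "('a, 'b) vec2" and t
  assume f: "f \<in> field_vecs C" and g: "g \<in> field_vecs C"
  obtain q r where \<omega>': "\<omega> = (q, r)" by (cases \<omega>)
  have qr [simp]: "q $ j \<in> flds C" "r $ j \<in> flds C" for j
    using \<omega> by (simp_all add: \<omega>' field_vecs_iff)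
  define S where "S u v = (\<Sum>j\<in>UNIV. \<Sum>k\<in>UNIV. intg C (u j k * dxinv C (v j k)) t)"
    for u v :: "'b \<Rightarrow> 'b \<Rightarrow> 'a"
  define T where "T f1 f2 g1 g2 =
      2 * \<i> * (\<Sum>j\<in>UNIV. intg C (f2 $ j * g1 $ j) t) - 2 * \<i> * (\<Sum>j\<in>UNIV. intg C (f1 $ j * g2 $ j) t)
      + S (\<lambda>j k. f1 $ j * q $ j) (\<lambda>j k. r $ k * g2 $ k)
      + S (\<lambda>j k. f1 $ j * q $ k) (\<lambda>j k. r $ k * g2 $ j)
      - S (\<lambda>j k. f1 $ j * q $ j) (\<lambda>j k. q $ k * g1 $ k)
      - S (\<lambda>j k. f1 $ j * q $ k) (\<lambda>j k. q $ j * g1 $ k)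
      - S (\<lambda>j k. f2 $ j * r $ j) (\<lambda>j k. r $ k * g2 $ k)
      - S (\<lambda>j k. f2 $ j * r $ k) (\<lambda>j k. r $ j * g2 $ k)
      + S (\<lambda>j k. f2 $ j * r $ j) (\<lambda>j k. q $ k * g1 $ k)
      + S (\<lambda>j k. f2 $ j * r $ k) (\<lambda>j k. q $ k * g1 $ j)" for f1 f2 g1 g2
  have T: "intg C (vdot2 (f1, f2) (L2 C \<omega> (g2, g1))) t = T f1 f2 g1 g2" for f1 f2 g1 g2
  proof -
    have "intg C (x * (cst C z * y)) t = z * intg C (x * y) t" for x y z
      using intg_scale[of z "x * y"] by (simp add: mult.left_commute)
    then show ?thesis
      by (simp add: \<omega>' vdot2_def vdot_def T_def S_def intg_add intg_diff intg_sum distrib_left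
          right_diff_distrib sum_distrib_left sum.distrib sum_subtractf sum_negf mult.assoc)
  qed
  obtain f1 f2 g1 g2 where fg: "f = (f1, f2)" "g = (g1, g2)"
    by (cases f; cases g)
  have [simp]: "f1 $ j \<in> flds C" "f2 $ j \<in> flds C" "g1 $ j \<in> flds C" "g2 $ j \<in> flds C" for j
    using f g by (simp_all add: fg field_vecs_iff)
  note S = sum_intg_dxinv_swap[where A = UNIV and B = UNIV and t = t]
  \<comment> \<open>Three index patterns occur: \<open>S1\<close> for the outer products such as
    \<open>q $ j * dxinv C (r $ k * _)\<close>, \<open>S2\<close> for the multiples of the identity,
    \<open>S3\<close> for the outer products with exchanged indices. \<open>S1\<close> and
    \<open>S3\<close> also require renaming \<open>j\<close> and \<open>k\<close>.\<close>
  have S1: "S (\<lambda>j k. x $ j * y $ j) (\<lambda>j k. z $ k * w $ k) = - S (\<lambda>j k. w $ j * z $ j) (\<lambda>j k. y $ k * x $ k)"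
    if "\<And>j. x $ j \<in> flds C" "\<And>j. y $ j \<in> flds C" "\<And>j. z $ j \<in> flds C" "\<And>j. w $ j \<in> flds C"
    for x y z w
    unfolding S_def using S(2)[of "\<lambda>j k. x $ j * y $ j" "\<lambda>j k. z $ k * w $ k"]
    by (simp add: that fields_mult mult.commute)
  have S2: "S (\<lambda>j k. x $ j * y $ k) (\<lambda>j k. z $ k * w $ j) = - S (\<lambda>j k. w $ j * z $ k) (\<lambda>j k. y $ k * x $ j)"
    if "\<And>j. x $ j \<in> flds C" "\<And>j. y $ j \<in> flds C" "\<And>j. z $ j \<in> flds C" "\<And>j. w $ j \<in> flds C"
    for x y z w
    unfolding S_def using S(1)[of "\<lambda>j k. x $ j * y $ k" "\<lambda>j k. z $ k * w $ j"]
    by (simp add: that fields_mult mult.commute)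
  have S3: "S (\<lambda>j k. x $ j * y $ k) (\<lambda>j k. y $ j * w $ k) = - S (\<lambda>j k. w $ j * y $ k) (\<lambda>j k. y $ j * x $ k)"
    if "\<And>j. x $ j \<in> flds C" "\<And>j. y $ j \<in> flds C" "\<And>j. w $ j \<in> flds C" for x y w
    unfolding S_def using S(2)[of "\<lambda>j k. x $ j * y $ k" "\<lambda>j k. y $ j * w $ k"]
    by (simp add: that fields_mult mult.commute)
  have c: "(\<Sum>j\<in>UNIV. intg C (f2 $ j * g1 $ j) t) = (\<Sum>j\<in>UNIV. intg C (g1 $ j * f2 $ j) t)"
    "(\<Sum>j\<in>UNIV. intg C (f1 $ j * g2 $ j) t) = (\<Sum>j\<in>UNIV. intg C (g2 $ j * f1 $ j) t)"
    by (simp_all only: mult.commute)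
  have "S (\<lambda>j k. f1 $ j * q $ j) (\<lambda>j k. r $ k * g2 $ k) = - S (\<lambda>j k. g2 $ j * r $ j) (\<lambda>j k. q $ k * f1 $ k)"
    "S (\<lambda>j k. f1 $ j * q $ j) (\<lambda>j k. q $ k * g1 $ k) = - S (\<lambda>j k. g1 $ j * q $ j) (\<lambda>j k. q $ k * f1 $ k)"
    "S (\<lambda>j k. f2 $ j * r $ j) (\<lambda>j k. r $ k * g2 $ k) = - S (\<lambda>j k. g2 $ j * r $ j) (\<lambda>j k. r $ k * f2 $ k)"
    "S (\<lambda>j k. f2 $ j * r $ j) (\<lambda>j k. q $ k * g1 $ k) = - S (\<lambda>j k. g1 $ j * q $ j) (\<lambda>j k. r $ k * f2 $ k)"
    "S (\<lambda>j k. f1 $ j * q $ k) (\<lambda>j k. r $ k * g2 $ j) = - S (\<lambda>j k. g2 $ j * r $ k) (\<lambda>j k. q $ k * f1 $ j)"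
    "S (\<lambda>j k. f2 $ j * r $ k) (\<lambda>j k. q $ k * g1 $ j) = - S (\<lambda>j k. g1 $ j * q $ k) (\<lambda>j k. r $ k * f2 $ j)"
    "S (\<lambda>j k. f1 $ j * q $ k) (\<lambda>j k. q $ j * g1 $ k) = - S (\<lambda>j k. g1 $ j * q $ k) (\<lambda>j k. q $ j * f1 $ k)"
    "S (\<lambda>j k. f2 $ j * r $ k) (\<lambda>j k. r $ j * g2 $ k) = - S (\<lambda>j k. g2 $ j * r $ k) (\<lambda>j k. r $ j * f2 $ k)"
    by (rule S1 S2 S3; simp)+
  note S_eqs = this
  have "T f1 f2 g1 g2 = - T g1 g2 f1 f2"
    unfolding T_def c S_eqs by simp
  then show "intg C (vdot2 f (L2 C \<omega> (prod.swap g))) t = - intg C (vdot2 (L2 C \<omega> (prod.swap f)) g) t"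
    unfolding vdot2_commute[of _ g] by (simp add: fg T del: L2.simps)
qed

theorem JK_pow_skew:
  assumes \<omega>: "\<omega> \<in> field_vecs C"
  shows "skew_symmetric C (\<lambda>f. J_op C ((K_op C \<omega> ^^ n) f))"
proof -
  have J_adj: "intg C (vdot2 f (J_op C g)) t = - intg C (vdot2 (J_op C f) g) t"
    if "f \<in> field_vecs C" "g \<in> field_vecs C" for f g :: "('a, 'b) vec2" and t
    using J_skew that unfolding skew_symmetric_def by blast
  have JK_adj: "intg C (vdot2 f (J_op C (K_op C \<omega> g))) t = intg C (vdot2 (K_op C \<omega> f) (J_op C g)) t"
    if "f \<in> field_vecs C" "g \<in> field_vecs C" for f g t
  proof -
    \<comment> \<open>Skewness of \<open>J K\<close> and then of \<open>J\<close> gives two signs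
      that cancel.\<close>
    have "intg C (vdot2 f (J_op C (K_op C \<omega> g))) t = - intg C (vdot2 (J_op C (K_op C \<omega> f)) g) t"
      using L2_swap_skew[OF \<omega>] that by (simp add: skew_symmetric_def JK \<omega>)
    also have "\<dots> = intg C (vdot2 (K_op C \<omega> f) (J_op C g)) t"
      by (simp add: J_adj K_fields \<omega> that)
    finally show ?thesis .
  qed
  have Kn: "(K_op C \<omega> ^^ n) f \<in> field_vecs C" if "f \<in> field_vecs C" for f n
    by (induction n) (simp_all add: that K_fields \<omega>)
  \<comment> \<open>The factors \<open>K\<close> move to the left argument one at a time, so
    \<open>f\<close> must be arbitrary in the induction.\<close>
  have "intg C (vdot2 f (J_op C ((K_op C \<omega> ^^ n) g))) t = intg C (vdot2 ((K_op C \<omega> ^^ n) f) (J_op C g)) t"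
    if "f \<in> field_vecs C" "g \<in> field_vecs C" for f g t
    using that(1)
  proof (induction n arbitrary: f)
    case (Suc n)
    have "intg C (vdot2 f (J_op C ((K_op C \<omega> ^^ Suc n) g))) t =
        intg C (vdot2 (K_op C \<omega> f) (J_op C ((K_op C \<omega> ^^ n) g))) t"
      by (simp add: JK_adj Suc.prems Kn that(2))
    also have "\<dots> = intg C (vdot2 ((K_op C \<omega> ^^ Suc n) f) (J_op C g)) t"
      using Suc.IH[OF K_fields[OF \<omega> Suc.prems]] by (simp add: funpow_swap1)
    finally show ?case .
  qed simp
  then show ?thesis
    by (simp add: skew_symmetric_def J_adj Kn)
qed

end

section \<open>The zero-curvature equation\<close>

text \<open>The condition \<open>h 0 = 0\<close> keeps the support bounded below, so
  \<open>Abs_fls\<close> is applied to a genuine Laurent series.\<close>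

lemma fls_map_nth [simp]: "h 0 = 0 \<Longrightarrow> fls_nth (fls_map h f) k = h (fls_nth f k)"
  unfolding fls_map_def
  by (rule nth_Abs_fls_lower_bound[of "fls_subdegree f"]) simp

lemma fls_plus_nth [simp]: "fls_nth (fls_plus f) k = (if k \<le> 0 then fls_nth f k else 0)"
  unfolding fls_plus_def
  by (rule nth_Abs_fls_lower_bound[of "fls_subdegree f"]) simp

lemma fls_map_fps_to_fls: "h 0 = 0 \<Longrightarrow> fls_map h (fps_to_fls F) = fps_to_fls (fps_map h F)"
  by (simp add: fls_eq_iff)

lemma fps_to_fls_sum: "fps_to_fls (sum F A) = (\<Sum>i\<in>A. fps_to_fls (F i))"
  by (induction A rule: infinite_finite_induct) simp_all

lemma comm_fps_to_fls: "comm (mmap fps_to_fls A) (mmap fps_to_fls B) = mmap fps_to_fls (comm A B)"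
  by (simp add: comm_def matrix_matrix_mult_def vec_eq_iff fps_to_fls_sum fls_times_fps_to_fls)

lemma comm_scale: "comm A (mmap ((*) s) B) = mmap ((*) s) (comm A B)"
  by (simp add: comm_def matrix_matrix_mult_def vec_eq_iff sum_distrib_left right_diff_distrib
      mult.left_commute mult.assoc)

lemma W_mat_eq: "W_mat C \<alpha> \<omega> = mmap fps_to_fls (W_fps C \<alpha> \<omega>)"
  by (simp add: W_mat_def W_fps_def bmat_eq_iff even_series_def odd_series_def even_fps_def odd_fps_def)

lemma U_mat_eq: "U_mat C \<omega> = mmap fps_to_fls (U_fps C \<omega>)"
  by (cases \<omega>)
    (simp add: U_mat_def U_fps_def bmat_eq_iff sigma3_def mat_def fls_times_fps_to_fls
      fps_to_fls_power mult.commute)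

text \<open>After multiplication by \<open>\<lambda>^(2 * n)\<close>, nonnegative powers of
  \<lambda> come from orders 0 to \<open>2 * n\<close> in \<zeta>; \<open>fps_cutoff\<close> keeps
  the orders strictly below its argument.\<close>

lemma V_mat_eq:
  "V_mat C \<alpha> n \<omega> = mmap ((*) (fls_X_inv ^ (2 * n)))
    (mmap fps_to_fls (mmap (fps_cutoff (2 * n + 1)) (W_fps C \<alpha> \<omega>)))"
proof -
  have "fls_plus (fls_X_inv ^ m * fps_to_fls F) = fls_X_inv ^ m * fps_to_fls (fps_cutoff (m + 1) F)"
    for m and F :: "'a fps"
    by (auto simp: fls_eq_iff fls_X_inv_power_times_conv_shift)
  then show ?thesis
    by (simp add: V_mat_def W_mat_eq vec_eq_iff)
qed

context spatial_calculus
begin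

text \<open>Truncating \<open>W\<close> leaves an error only in one coefficient: the next one vanishes because the
  last retained coefficient is block diagonal, hence commutes with \<open>\<sigma>\<^sub>3\<close>.\<close>

lemma comm_truncated_nth:
  assumes "\<omega> \<in> field_vecs C"
  shows "fps_nth (comm (U_fps C \<omega>) (mmap (fps_cutoff (2 * n + 1)) (W_fps C \<alpha> \<omega>)) $ i $ j) k =
    (if k \<le> 2 * n + 1 then dx C (fps_nth (W_fps C \<alpha> \<omega> $ i $ j) k) else 0)"
proof (cases "k \<le> 2 * n + 1")
  case True
  \<comment> \<open>Since the entries of \<open>U\<close> have no constant term, order
    \<open>k\<close> uses only orders of \<open>W\<close> below \<open>k\<close>, and none of these
    is cut off.\<close>
  have cut: "fps_nth (F * fps_cutoff (2 * n + 1) G) k = fps_nth (F * G) k"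
    "fps_nth (fps_cutoff (2 * n + 1) G * F) k = fps_nth (G * F) k"
    if "fps_nth F 0 = 0" for F G :: "'a fps"
  proof -
    show "fps_nth (F * fps_cutoff (2 * n + 1) G) k = fps_nth (F * G) k"
      unfolding fps_mult_nth
    proof (rule sum.cong)
      fix i assume "i \<in> {0..k}"
      then show "fps_nth F i * fps_nth (fps_cutoff (2 * n + 1) G) (k - i) = fps_nth F i * fps_nth G (k - i)"
        using that True by (cases "i = 0") auto
    qed simp
    then show "fps_nth (fps_cutoff (2 * n + 1) G * F) k = fps_nth (G * F) k"
      by (simp only: mult.commute)
  qed
  have "fps_nth (comm (U_fps C \<omega>) (mmap (fps_cutoff (2 * n + 1)) (W_fps C \<alpha> \<omega>)) $ i $ j) k =
      fps_nth (comm (U_fps C \<omega>) (W_fps C \<alpha> \<omega>) $ i $ j) k"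
    by (simp only: comm_def matrix_matrix_mult_def vec_lambda_beta vector_minus_component fps_sub_nth
        fps_sum_nth mmap_nth cut[OF U_fps_nth_0])
  also have "\<dots> = dx C (fps_nth (W_fps C \<alpha> \<omega> $ i $ j) k)"
    unfolding W_fps_lax[OF assms, symmetric] by simp
  finally show ?thesis using True by simp
next
  case False
  have two: "2 * u * f = u * f + u * f" for u f :: "'a fps"
    by (simp add: algebra_simps)
  have X: "fps_nth (fps_X * fps_const f * fps_cutoff (2 * n + 1) F) k = 0"
    "fps_nth (fps_cutoff (2 * n + 1) F * (fps_X * fps_const f)) k = 0" for f and F :: "'a fps"
    using False unfolding mult.commute[of "fps_cutoff _ _"] fps_X_const_mult_nth by auto
  \<comment> \<open>The factor \<open>fps_X\<close> squared could still reach the retained order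
    \<open>2 * n\<close>, namely when \<open>k\<close> is \<open>2 * n + 2\<close>, but an odd
    series has no coefficient there.\<close>
  have X2: "fps_nth (fps_const f * fps_X\<^sup>2 * fps_cutoff (2 * n + 1) (odd_fps g)) k = 0"
    for f :: 'a and g
  proof (cases "k - 2 = 2 * n")
    case True
    then show ?thesis unfolding fps_X_const_mult_nth True by simp
  next
    case False
    then show ?thesis
      using \<open>\<not> k \<le> 2 * n + 1\<close> unfolding fps_X_const_mult_nth by simp
  qed
  show ?thesis
    using False unfolding U_fps_def W_fps_def mmap_block comm_block
    by (cases i; cases j)
      (simp_all only: block_nth vec_lambda_beta vmap_nth vdot_def two fps_add_nth fps_sub_nth
        fps_sum_nth X X2 mmap_nth, simp_all)
qed

end

context formal_calculus
begin

sublocale spatial_calculus C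
  by (rule spatial_calculus)

text \<open>Once \<open>\<lambda>^(2 * n)\<close> is factored out, the left side of the equation is
  a matrix \<open>E\<close> of power series. Its orders up to \<open>2 * n\<close> vanish by the Lax
  equation and those above \<open>2 * n + 1\<close> by the truncation lemma, so the single order
  \<open>2 * n + 1\<close> carries the evolution equation.\<close>

lemma zero_curvature_iff:
  fixes \<omega> :: "('a, 'n::finite) vec2"
  assumes "\<omega> \<in> field_vecs C"
  shows "zero_curvature C (U_mat C \<omega>) (V_mat C \<alpha> n \<omega>) \<longleftrightarrow>
    vmap2 (dt C) \<omega> = - J_op C (c_coeff C \<alpha> \<omega> n, b_coeff C \<alpha> \<omega> n)"
proof -
  interpret t: derivation "dt C"
    by standard (simp_all add: dt_add dt_mult)
  define s :: "'a fls" where "s = fls_X_inv ^ (2 * n)"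
  define U where "U = U_fps C \<omega>"
  define W where "W = W_fps C \<alpha> \<omega>"
  define P where "P = mmap (fps_cutoff (2 * n + 1)) W"
  define Ut where "Ut = mmap (fps_map (dt C)) U"
  define Px where "Px = mmap (fps_map (dx C)) P"
  define E where "E = mmap ((*) (fps_X ^ (2 * n))) Ut - Px + comm U P"
  have sX: "s * fps_to_fls (fps_X ^ (2 * n) * F) = fps_to_fls F" for F
    by (simp add: s_def fls_times_fps_to_fls fps_to_fls_power fls_eq_iff
        fls_X_inv_power_times_conv_shift fls_X_power_times_conv_shift)
  have s_dx: "fls_map (dx C) (s * f) = s * fls_map (dx C) f" for f
    by (simp add: fls_eq_iff s_def fls_X_inv_power_times_conv_shift)
  have s_inj: "s * fps_to_fls F = 0 \<longleftrightarrow> F = 0" for F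
    by (simp add: s_def fls_X_inv_power_times_conv_shift fls_shift_eq0_iff)
  have "mmap (fls_map (dt C)) (U_mat C \<omega>) = mmap ((*) s) (mmap fps_to_fls (mmap ((*) (fps_X ^ (2 * n))) Ut))"
    by (simp add: vec_eq_iff U_mat_eq sX fls_map_fps_to_fls Ut_def U_def)
  moreover have "mmap (fls_map (dx C)) (V_mat C \<alpha> n \<omega>) = mmap ((*) s) (mmap fps_to_fls Px)"
    by (simp add: vec_eq_iff V_mat_eq s_def[symmetric] s_dx fls_map_fps_to_fls Px_def P_def W_def)
  moreover have "comm (U_mat C \<omega>) (V_mat C \<alpha> n \<omega>) = mmap ((*) s) (mmap fps_to_fls (comm U P))"
    by (simp only: V_mat_eq U_mat_eq s_def[symmetric] comm_scale comm_fps_to_fls U_def P_def W_def)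
  ultimately have "mmap (fls_map (dt C)) (U_mat C \<omega>) - mmap (fls_map (dx C)) (V_mat C \<alpha> n \<omega>)
      + comm (U_mat C \<omega>) (V_mat C \<alpha> n \<omega>) = mmap (\<lambda>F. s * fps_to_fls F) E"
    by (simp add: E_def vec_eq_iff algebra_simps)
  then have zc: "zero_curvature C (U_mat C \<omega>) (V_mat C \<alpha> n \<omega>) \<longleftrightarrow> (\<forall>i j. E $ i $ j = 0)"
    unfolding zero_curvature_def by (simp add: vec_eq_iff s_inj)
  have Ut: "fps_nth (Ut $ i $ j) m = (if m = 1 then dt C (Q_mat \<omega> $ i $ j) else 0)" for i j m
    by (cases \<omega>; cases i; cases j)
      (simp_all add: Ut_def U_def U_fps_def mat_def fps_X_power_nth t.uminus dt_cst)
  have E_nth: "fps_nth (E $ i $ j) k =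
      (if k = 2 * n + 1 then dt C (Q_mat \<omega> $ i $ j) + dx C (fps_nth (W $ i $ j) (2 * n + 1)) else 0)" for i j k
    using comm_truncated_nth[OF assms, of n \<alpha> i j k, folded U_def W_def, folded P_def]
    by (auto simp: E_def fps_X_power_mult_nth Ut Px_def) (auto simp: P_def)
  have "(\<forall>i j. E $ i $ j = 0) \<longleftrightarrow>
      (\<forall>i j. dt C (Q_mat \<omega> $ i $ j) + dx C (fps_nth (W $ i $ j) (2 * n + 1)) = 0)"
    by (simp add: fps_eq_iff E_nth)
  \<comment> \<open>At the odd order \<open>2 * n + 1\<close> the diagonal blocks of
    \<open>W\<close> vanish, so only the equations for \<open>q\<close> and \<open>r\<close> are
    left.\<close>
  also have "\<dots> \<longleftrightarrow> vmap2 (dt C) \<omega> = - J_op C (c_coeff C \<alpha> \<omega> n, b_coeff C \<alpha> \<omega> n)"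
    by (cases \<omega>)
      (auto simp: split_option_all W_def W_fps_def vmap2_def J_op_def vec_eq_iff eq_neg_iff_add_eq_0)
  finally show ?thesis
    unfolding zc .
qed

text \<open>The definite description needs uniqueness: two candidates have the same pairing with
  every direction, and directions with a single nonzero component reduce their equality to
  \<open>nondegenerate\<close>.\<close>

lemma variational_derivative_eqI:
  fixes G :: "('a, 'n::finite) vec2"
  assumes G: "has_variational_derivative C H \<omega> G"
  shows "variational_derivative C H \<omega> = G"
  unfolding variational_derivative_def
proof (rule the_equality[where a = G])
  show "has_variational_derivative C H \<omega> G" by fact
next
  fix G' assume G': "has_variational_derivative C H \<omega> G'"
  have flds: "G \<in> field_vecs C" "G' \<in> field_vecs C"
    using G G' by (simp_all add: has_variational_derivative_def)
  have eq: "intg C (vdot2 \<eta> G') t = intg C (vdot2 \<eta> G) t" if "\<eta> \<in> field_vecs C" for \<eta> t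
    using G G' that unfolding has_variational_derivative_def by (blast intro: DERIV_unique)
  have dot: "vdot (\<chi> i. if i = j then g else 0) v = g * v $ j" for g :: 'a and j :: 'n and v
    by (simp add: vdot_def if_distrib if_distribR cong: if_cong)
  have dot0: "vdot 0 v = 0" for v :: "'a ^ 'n"
    by (simp add: vdot_def)
  have "fst G' $ j - fst G $ j = 0" for j
  proof (rule nondegenerate)
    fix g t assume "g \<in> flds C"
    then show "intg C (g * (fst G' $ j - fst G $ j)) t = 0"
      using eq[of "((\<chi> i. if i = j then g else 0), 0)" t]
      by (simp add: field_vecs_iff vdot2_def dot dot0 right_diff_distrib intg_diff)
  qed (use flds in \<open>simp add: field_vecs_def fields_diff\<close>)
  moreover have "snd G' $ j - snd G $ j = 0" for j
  proof (rule nondegenerate)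
    fix g t assume "g \<in> flds C"
    then show "intg C (g * (snd G' $ j - snd G $ j)) t = 0"
      using eq[of "(0, (\<chi> i. if i = j then g else 0))" t]
      by (simp add: field_vecs_iff vdot2_def dot dot0 right_diff_distrib intg_diff)
  qed (use flds in \<open>simp add: field_vecs_def fields_diff\<close>)
  ultimately show "G' = G"
    by (simp add: prod_eq_iff vec_eq_iff)
qed

end

theorem mainTheorem2:
  fixes C :: "'a::comm_ring_1 calculus"
    and \<omega> :: "('a, 'n::finite) vec2"
    and \<alpha> :: complex
    and n :: nat
  assumes "formal_calculus C"
    and "\<omega> \<in> field_vecs C"
  shows "mmap (fls_map (dx C)) (W_mat C \<alpha> \<omega>) = comm (U_mat C \<omega>) (W_mat C \<alpha> \<omega>)
    \<and> has_variational_derivative C (hamiltonian C \<alpha> n) \<omega> (c_coeff C \<alpha> \<omega> n, b_coeff C \<alpha> \<omega> n)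
    \<and> (c_coeff C \<alpha> \<omega> n, b_coeff C \<alpha> \<omega> n) = variational_derivative C (hamiltonian C \<alpha> n) \<omega>
    \<and> (zero_curvature C (U_mat C \<omega>) (V_mat C \<alpha> n \<omega>) \<longleftrightarrow>
         vmap2 (dt C) \<omega> = - J_op C (variational_derivative C (hamiltonian C \<alpha> n) \<omega>))
    \<and> - J_op C (variational_derivative C (hamiltonian C \<alpha> n) \<omega>) =
        - J_op C ((K_op C \<omega> ^^ n) (variational_derivative C (hamiltonian C \<alpha> 0) \<omega>))
    \<and> skew_symmetric C (\<lambda>f. J_op C ((K_op C \<omega> ^^ n) f))"
proof -
  interpret formal_calculus C by fact
  have W: "mmap (fls_map (dx C)) (W_mat C \<alpha> \<omega>) = comm (U_mat C \<omega>) (W_mat C \<alpha> \<omega>)"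
    unfolding W_mat_eq U_mat_eq comm_fps_to_fls W_fps_lax[OF assms(2), symmetric]
    by (simp add: vec_eq_iff fls_map_fps_to_fls)
  \<comment> \<open>Stated for every \<open>m\<close>, since the theorem uses both index
    \<open>n\<close> and index 0.\<close>
  have H: "has_variational_derivative C (hamiltonian C \<alpha> m) \<omega> (c_coeff C \<alpha> \<omega> m, b_coeff C \<alpha> \<omega> m)" for m
    by (rule has_variational_derivative_hamiltonian[OF assms(2)])
  have "variational_derivative C (hamiltonian C \<alpha> m) \<omega> = (c_coeff C \<alpha> \<omega> m, b_coeff C \<alpha> \<omega> m)" for m
    by (rule variational_derivative_eqI[OF H])
  then show ?thesis
    by (simp add: W H zero_curvature_iff assms(2) K_pow_bc JK_pow_skew)
qed

end
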